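(* Let $X$ be a real Banach lattice, let $E\subset X$ be a closed subspace, and let $(e_n)_{n\in\mathbb{N}}$ be a semi-normalized, unconditional, uniformly quasi-greedy basis of $E$. Then $(\lambda_n e_n)$ is uniformly quasi-greedy for all real sequences $(\lambda_n)$ with $0<\inf_{n\in\mathbb{N}}|\lambda_n|\leq\sup_{n\in\mathbb{N}}|\lambda_n|<\infty$.
   Context: All Banach spaces are over $\mathbb{R}$; $E$ carries the norm of $X$. "Basis" means Schauder basis; semi-normalized means $0<\inf_n\|e_n\|\le\sup_n\|e_n\|<\infty$; $e_n^*$ denotes the biorthogonal (coefficient) functionals and $\mathrm{supp}(x)=\{n: e_n^*(x)\ne 0\}$. The basis is unconditional if every permutation of it is a basic sequence. Greedy orderings: a greedy ordering of $x\in E$ is an injective map $\pi:\mathbb{N}\to\mathbb{N}$ with $\mathrm{supp}(x)\subset\pi(\mathbb{N})$ such that $(|e^*_{\pi(n)}(x)|)_n$ is non-increasing. The natural greedy ordering $\sigma$ of $x$ is the greedy ordering such that $j<k$ implies either $|e^*_{\sigma(j)}(x)|>|e^*_{\sigma(k)}(x)|$, or $|e^*_{\sigma(j)}(x)|=|e^*_{\sigma(k)}(x)|$ and $\sigma(j)<\sigma(k)$. The $m$-th natural greedy sum is $\mathcal{G}_m(x)=\sum_{n=1}^m e^*_{\sigma(n)}(x)e_{\sigma(n)}$. A sequence $(x_m)$ in $X$ converges uniformly to $x$ if there is $e\in X$ such that for every $\epsilon>0$ there is $m_0$ with $|x_m-x|\le\epsilon e$ for all $m\ge m_0$. The basis $(e_n)$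 of $E\subset X$ is uniformly quasi-greedy if $\mathcal{G}_m(x)$ converges uniformly to $x$ for every $x\in E$. For a scaled basis $(\lambda_n e_n)$ the same definitions are used with its own biorthogonal functionals $\lambda_n^{-1}e_n^*$. *)

theory Defs
  imports "HOL-Analysis.Analysis" "HOL-Library.Lattice_Algebras"
begin

class banach_lattice = banach + ordered_real_vector + lattice_ab_group_add_abs +
  assumes norm_abs_mono: "\<bar>x\<bar> \<le> \<bar>y\<bar> \<Longrightarrow> norm x \<le> norm y"

instance real :: banach_lattice
  by standard auto

definition schauder_basis :: "(nat \<Rightarrow> 'a::banach) \<Rightarrow> 'a set \<Rightarrow> bool" where
  "schauder_basis e E \<longleftrightarrow>
     (\<forall>n. e n \<in> E) \<and> (\<forall>x\<in>E. \<exists>!a. (\<lambda>n. a n *\<^sub>R e n) sums x)"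

definition basic_sequence :: "(nat \<Rightarrow> 'a::banach) \<Rightarrow> bool" where
  "basic_sequence e \<longleftrightarrow> schauder_basis e (closure (span (range e)))"

definition unconditional :: "(nat \<Rightarrow> 'a::banach) \<Rightarrow> bool" where
  "unconditional e \<longleftrightarrow> (\<forall>\<pi>. bij \<pi> \<longrightarrow> basic_sequence (e \<circ> \<pi>))"

definition semi_normalized :: "(nat \<Rightarrow> 'a::banach) \<Rightarrow> bool" where
  "semi_normalized e \<longleftrightarrow>
     0 < (INF n. norm (e n)) \<and> bdd_above (range (\<lambda>n. norm (e n)))"

text \<open>\<open>coeff_fun e n x\<close> is \<open>e\<^sub>n\<^sup>*(x)\<close>; it is meaningful only for \<open>x\<close> in the space of which
  \<open>e\<close> is a basis.\<close>

definition coeff_fun :: "(nat \<Rightarrow> 'a::banach) \<Rightarrow> nat \<Rightarrow> 'a \<Rightarrow> real" where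
  "coeff_fun e n x = (THE a. (\<lambda>k. a k *\<^sub>R e k) sums x) n"

definition basis_supp :: "(nat \<Rightarrow> 'a::banach) \<Rightarrow> 'a \<Rightarrow> nat set" where
  "basis_supp e x = {n. coeff_fun e n x \<noteq> 0}"

definition greedy_ordering :: "(nat \<Rightarrow> 'a::banach) \<Rightarrow> 'a \<Rightarrow> (nat \<Rightarrow> nat) \<Rightarrow> bool" where
  "greedy_ordering e x \<pi> \<longleftrightarrow>
     inj \<pi> \<and> basis_supp e x \<subseteq> range \<pi> \<and> decseq (\<lambda>n. \<bar>coeff_fun e (\<pi> n) x\<bar>)"

definition natural_greedy_ordering ::
  "(nat \<Rightarrow> 'a::banach) \<Rightarrow> 'a \<Rightarrow> (nat \<Rightarrow> nat) \<Rightarrow> bool" where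
  "natural_greedy_ordering e x \<sigma> \<longleftrightarrow>
     greedy_ordering e x \<sigma> \<and>
     (\<forall>j k. j < k \<longrightarrow>
        \<bar>coeff_fun e (\<sigma> j) x\<bar> > \<bar>coeff_fun e (\<sigma> k) x\<bar> \<or>
        \<bar>coeff_fun e (\<sigma> j) x\<bar> = \<bar>coeff_fun e (\<sigma> k) x\<bar> \<and> \<sigma> j < \<sigma> k)"

text \<open>The natural greedy ordering is unique if \<open>x\<close> has infinite support. If the support is finite,
  two natural greedy orderings can differ only at indices with zero coefficient, so the choice made
  by \<open>SOME\<close> does not affect the greedy sums.\<close>

definition greedy_sum :: "(nat \<Rightarrow> 'a::banach) \<Rightarrow> nat \<Rightarrow> 'a \<Rightarrow> 'a" where
  "greedy_sum e m x =
     (let \<sigma> = (SOME \<sigma>. natural_greedy_ordering e x \<sigma>)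
      in \<Sum>n<m. coeff_fun e (\<sigma> n) x *\<^sub>R e (\<sigma> n))"

definition converges_uniformly :: "(nat \<Rightarrow> 'a::banach_lattice) \<Rightarrow> 'a \<Rightarrow> bool" where
  "converges_uniformly s x \<longleftrightarrow>
     (\<exists>u. \<forall>\<epsilon>>0. \<exists>m0. \<forall>m\<ge>m0. \<bar>s m - x\<bar> \<le> \<epsilon> *\<^sub>R u)"

definition uniformly_quasi_greedy :: "(nat \<Rightarrow> 'a::banach_lattice) \<Rightarrow> 'a set \<Rightarrow> bool" where
  "uniformly_quasi_greedy e E \<longleftrightarrow>
     schauder_basis e E \<and> (\<forall>x\<in>E. converges_uniformly (\<lambda>m. greedy_sum e m x) x)"

lemma coeff_fun_eqI:
  assumes "schauder_basis e E" "x \<in> E" "(\<lambda>k. a k *\<^sub>R e k) sums x"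
  shows "coeff_fun e n x = a n"
proof -
  have "\<exists>!a. (\<lambda>k. a k *\<^sub>R e k) sums x"
    using assms(1,2) unfolding schauder_basis_def by blast
  then have "(THE a. (\<lambda>k. a k *\<^sub>R e k) sums x) = a"
    using assms(3) the1_equality[where P="\<lambda>a. (\<lambda>k. a k *\<^sub>R e k) sums x"] by simp
  then show ?thesis by (simp add: coeff_fun_def)
qed

lemma schauder_basis_scale:
  fixes l :: "nat \<Rightarrow> real"
  assumes "schauder_basis e E" "subspace E" "\<And>n. l n \<noteq> 0"
  shows "schauder_basis (\<lambda>n. l n *\<^sub>R e n) E"
  unfolding schauder_basis_def
proof (intro conjI allI ballI)
  show "l n *\<^sub>R e n \<in> E" for n
    using assms(1,2) by (auto simp: schauder_basis_def subspace_scale)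
next
  fix x assume "x \<in> E"
  then have ex1: "\<exists>!a. (\<lambda>k. a k *\<^sub>R e k) sums x"
    using assms(1) unfolding schauder_basis_def by blast
  then obtain a where a: "(\<lambda>k. a k *\<^sub>R e k) sums x"
    and uniq: "\<And>b. (\<lambda>k. b k *\<^sub>R e k) sums x \<Longrightarrow> b = a"
    by (elim ex1E) blast
  show "\<exists>!b. (\<lambda>k. b k *\<^sub>R l k *\<^sub>R e k) sums x"
  proof (rule ex1I[of _ "\<lambda>k. a k / l k"])
    show "(\<lambda>k. (a k / l k) *\<^sub>R l k *\<^sub>R e k) sums x"
      using a assms(3) by simp
  next
    fix b assume "(\<lambda>k. b k *\<^sub>R l k *\<^sub>R e k) sums x"
    then have "(\<lambda>k. (b k * l k) *\<^sub>R e k) sums x" by simp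
    then have "(\<lambda>k. b k * l k) = a"
      by (rule uniq)
    then show "b = (\<lambda>k. a k / l k)" using assms(3) by (auto simp: fun_eq_iff field_simps)
  qed
qed

text \<open>The functionals attached to the scaled basis are \<open>l\<^sub>n\<^sup>-\<^sup>1 e\<^sub>n\<^sup>*\<close>.\<close>

lemma coeff_fun_scale:
  fixes l :: "nat \<Rightarrow> real"
  assumes "schauder_basis e E" "subspace E" "\<And>n. l n \<noteq> 0" "x \<in> E"
  shows "coeff_fun (\<lambda>n. l n *\<^sub>R e n) n x = inverse (l n) * coeff_fun e n x"
proof -
  obtain a where a: "(\<lambda>k. a k *\<^sub>R e k) sums x"
    using assms(1,4) unfolding schauder_basis_def by blast
  have "(\<lambda>k. (inverse (l k) * a k) *\<^sub>R l k *\<^sub>R e k) sums x"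
    using a assms(3) by (simp add: field_simps)
  from coeff_fun_eqI[OF schauder_basis_scale[OF assms(1-3)] assms(4) this]
  show ?thesis using coeff_fun_eqI[OF assms(1,4) a] by simp
qed

end

(* Let y = sum (e_n^*(x) / l_n) e_n, which exists by unconditionality. The natural greedy ordering
   sigma of x with respect to (l_n e_n) is that of y with respect to (e_n), so the greedy sums of x
   are the partial sums of sum_j l_(sigma j) v_j, where v_j = e_(sigma j)^*(y) e_(sigma j). For every
   set B of indices the subseries sum_(j in B) v_j runs through the greedy sums of a coordinate
   projection of y and hence converges uniformly. A gliding hump argument makes the tails of these
   subseries small uniformly in B; since [0,1]^F is the convex hull of {0,1}^F for finite F, the same
   bounds hold for all multipliers with values in [0,1], and thus for l. *)

theory Submission
  imports Defs
begin

section \<open>Order and uniform convergence in Banach lattices\<close>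

text \<open>Each subseries comes with its own regulator \<open>u\<close>, and no common regulator is
  available a priori. What can be made uniform is the norm: on a finite window all partial sums of a
  subseries lie below one vector \<open>w\<close> of small norm. Such bounds survive convex
  combinations, and blocks with geometrically small \<open>norm (w i)\<close> add up to a regulator
  of the multiplied series. A second obstacle lies in the definitions: a Schauder basis is only
  required to have unique expansions, and unconditionality only says that every permutation is a
  basic sequence. That a permuted expansion of \<open>x\<close> keeps its coefficients rests on
  continuity of the coefficient functionals, hence the Baire category argument in \<open>E\<close>.
  Convergence of all rearrangements then yields unordered summability, which provides
  \<open>y\<close>, the coordinate projections, and the equality of the uniform limit with
  \<open>x\<close>.\<close>

lemma abs_scaleR_le:
  fixes x :: "'a::banach_lattice"
  shows "\<bar>c *\<^sub>R x\<bar> \<le> \<bar>c\<bar> *\<^sub>R \<bar>x\<bar>"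
proof -
  have *: "\<bar>d *\<^sub>R x\<bar> \<le> d *\<^sub>R \<bar>x\<bar>" if "d \<ge> 0" for d
  proof (rule abs_leI)
    show "d *\<^sub>R x \<le> d *\<^sub>R \<bar>x\<bar>" by (intro scaleR_left_mono abs_ge_self that)
    have "d *\<^sub>R (- x) \<le> d *\<^sub>R \<bar>x\<bar>" by (intro scaleR_left_mono abs_ge_minus_self that)
    then show "- (d *\<^sub>R x) \<le> d *\<^sub>R \<bar>x\<bar>" by simp
  qed
  show ?thesis
  proof (cases "c \<ge> 0")
    case False
    then show ?thesis using *[of "- c"] by simp
  qed (use * in simp)
qed

lemma norm_le_if_abs_le:
  fixes x :: "'a::banach_lattice"
  assumes "\<bar>x\<bar> \<le> w"
  shows "norm x \<le> norm w"
proof -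
  have "0 \<le> w" using assms abs_ge_zero order_trans by blast
  then show ?thesis using assms by (intro norm_abs_mono) simp
qed

text \<open>The modulus is 1-Lipschitz by the reverse triangle inequality in the lattice and
  monotonicity of the norm.\<close>

lemma tendsto_abs_lattice:
  fixes f :: "'b \<Rightarrow> 'a::banach_lattice"
  assumes "(f \<longlongrightarrow> x) F"
  shows "((\<lambda>i. \<bar>f i\<bar>) \<longlongrightarrow> \<bar>x\<bar>) F"
proof -
  have "eventually (\<lambda>i. norm (\<bar>f i\<bar> - \<bar>x\<bar>) \<le> norm (f i - x)) F"
    by (intro always_eventually allI norm_abs_mono abs_triangle_ineq3)
  moreover have "((\<lambda>i. norm (f i - x)) \<longlongrightarrow> 0) F"
    using assms by (simp add: LIM_zero tendsto_norm_zero)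
  ultimately have "((\<lambda>i. \<bar>f i\<bar> - \<bar>x\<bar>) \<longlongrightarrow> 0) F"
    by (rule Lim_null_comparison)
  then show ?thesis by (rule LIM_zero_cancel)
qed

text \<open>The positive cone is the fixed point set of the continuous modulus, hence
  closed.\<close>

lemma nonneg_limit_lattice:
  fixes f :: "'b \<Rightarrow> 'a::banach_lattice"
  assumes "(f \<longlongrightarrow> x) F" "eventually (\<lambda>i. 0 \<le> f i) F" "F \<noteq> bot"
  shows "0 \<le> x"
proof -
  have "eventually (\<lambda>i. \<bar>f i\<bar> = f i) F"
    using assms(2) by eventually_elim simp
  then have "(f \<longlongrightarrow> \<bar>x\<bar>) F"
    using tendsto_abs_lattice[OF assms(1)] tendsto_cong by fast
  then have "x = \<bar>x\<bar>" using assms(1,3) tendsto_unique by blast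
  then show ?thesis by (metis abs_ge_zero)
qed

lemma le_limit_lattice:
  fixes f :: "'b \<Rightarrow> 'a::banach_lattice"
  assumes "(f \<longlongrightarrow> x) F" "eventually (\<lambda>i. f i \<le> w) F" "F \<noteq> bot"
  shows "x \<le> w"
proof -
  have "((\<lambda>i. w - f i) \<longlongrightarrow> w - x) F" using assms(1) by (intro tendsto_intros)
  moreover have "eventually (\<lambda>i. 0 \<le> w - f i) F" using assms(2) by eventually_elim simp
  ultimately have "0 \<le> w - x" using assms(3) by (rule nonneg_limit_lattice)
  then show ?thesis by simp
qed

section \<open>Uniform convergence: norm limit and linearity\<close>

lemma converges_uniformly_imp_tendsto:
  assumes "converges_uniformly s x"
  shows "s \<longlonglongrightarrow> x"
proof -
  obtain u where u: "\<And>\<epsilon>. \<epsilon> > 0 \<Longrightarrow> \<exists>m0. \<forall>m\<ge>m0. \<bar>s m - x\<bar> \<le> \<epsilon> *\<^sub>R u"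
    using assms unfolding converges_uniformly_def by blast
  show ?thesis
  proof (rule LIMSEQ_I)
    fix r :: real assume "r > 0"
    define \<epsilon> where "\<epsilon> = r / (norm u + 1)"
    have "norm u + 1 > 0" by (simp add: add_nonneg_pos)
    then have e: "\<epsilon> > 0" "\<epsilon> * norm u < r" using \<open>r > 0\<close>
      by (auto simp: \<epsilon>_def field_simps)
    then obtain m0 where "\<forall>m\<ge>m0. \<bar>s m - x\<bar> \<le> \<epsilon> *\<^sub>R u" using u by blast
    then have "\<forall>m\<ge>m0. norm (s m - x) \<le> norm (\<epsilon> *\<^sub>R u)" using norm_le_if_abs_le by blast
    then show "\<exists>no. \<forall>n\<ge>no. norm (s n - x) < r" using e by fastforce
  qed
qed

lemma converges_uniformly_const_eventually:
  assumes "eventually (\<lambda>m. s m = x) sequentially"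
  shows "converges_uniformly s x"
  unfolding converges_uniformly_def using assms
  by (intro exI[of _ 0]) (auto simp: eventually_sequentially)

lemma converges_uniformly_add:
  assumes "converges_uniformly s x" "converges_uniformly t y"
  shows "converges_uniformly (\<lambda>m. s m + t m) (x + y)"
proof -
  obtain u where u: "\<And>\<epsilon>. \<epsilon> > 0 \<Longrightarrow> \<exists>m0. \<forall>m\<ge>m0. \<bar>s m - x\<bar> \<le> \<epsilon> *\<^sub>R u"
    using assms(1) unfolding converges_uniformly_def by blast
  obtain v where v: "\<And>\<epsilon>. \<epsilon> > 0 \<Longrightarrow> \<exists>m0. \<forall>m\<ge>m0. \<bar>t m - y\<bar> \<le> \<epsilon> *\<^sub>R v"
    using assms(2) unfolding converges_uniformly_def by blast
  show ?thesis
    unfolding converges_uniformly_def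
  proof (intro exI[of _ "u + v"] allI impI)
    fix \<epsilon> :: real assume "\<epsilon> > 0"
    obtain m1 m2 where m1: "\<forall>m\<ge>m1. \<bar>s m - x\<bar> \<le> \<epsilon> *\<^sub>R u" and m2: "\<forall>m\<ge>m2. \<bar>t m - y\<bar> \<le> \<epsilon> *\<^sub>R v"
      using u[OF \<open>\<epsilon> > 0\<close>] v[OF \<open>\<epsilon> > 0\<close>] by blast
    have "\<bar>s m + t m - (x + y)\<bar> \<le> \<epsilon> *\<^sub>R (u + v)" if "m \<ge> max m1 m2" for m
    proof -
      have "\<bar>(s m - x) + (t m - y)\<bar> \<le> \<bar>s m - x\<bar> + \<bar>t m - y\<bar>" by (rule abs_triangle_ineq)
      also have "\<dots> \<le> \<epsilon> *\<^sub>R u + \<epsilon> *\<^sub>R v" using m1 m2 that by (intro add_mono) auto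
      finally show ?thesis by (simp add: algebra_simps)
    qed
    then show "\<exists>m0. \<forall>m\<ge>m0. \<bar>s m + t m - (x + y)\<bar> \<le> \<epsilon> *\<^sub>R (u + v)" by blast
  qed
qed

lemma converges_uniformly_scaleR:
  assumes "converges_uniformly s x"
  shows "converges_uniformly (\<lambda>m. c *\<^sub>R s m) (c *\<^sub>R x)"
proof -
  obtain u where u: "\<And>\<epsilon>. \<epsilon> > 0 \<Longrightarrow> \<exists>m0. \<forall>m\<ge>m0. \<bar>s m - x\<bar> \<le> \<epsilon> *\<^sub>R u"
    using assms unfolding converges_uniformly_def by blast
  have "\<exists>m0. \<forall>m\<ge>m0. \<bar>c *\<^sub>R s m - c *\<^sub>R x\<bar> \<le> \<epsilon> *\<^sub>R (\<bar>c\<bar> *\<^sub>R u)" if "\<epsilon> > 0" for \<epsilon>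
  proof -
    obtain m0 where m0: "\<forall>m\<ge>m0. \<bar>s m - x\<bar> \<le> \<epsilon> *\<^sub>R u" using u[OF \<open>\<epsilon> > 0\<close>] by blast
    have "\<bar>c *\<^sub>R s m - c *\<^sub>R x\<bar> \<le> \<epsilon> *\<^sub>R (\<bar>c\<bar> *\<^sub>R u)" if "m \<ge> m0" for m
    proof -
      have "\<bar>c *\<^sub>R (s m - x)\<bar> \<le> \<bar>c\<bar> *\<^sub>R \<bar>s m - x\<bar>" by (rule abs_scaleR_le)
      also have "\<dots> \<le> \<bar>c\<bar> *\<^sub>R \<epsilon> *\<^sub>R u" using m0 that by (intro scaleR_left_mono) auto
      finally show ?thesis by (simp add: algebra_simps)
    qed
    then show ?thesis by blast
  qed
  then show ?thesis unfolding converges_uniformly_def by blast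
qed

text \<open>Coordinate by coordinate, \<open>t\<close> is \<open>t g\<close> times a sequence with
  value 1 at \<open>g\<close> plus \<open>1 - t g\<close> times one with value 0 there. In the uses
  of the rule \<open>F\<close> contains every index that enters the sums, so only zero-one
  multipliers remain to be checked.\<close>

lemma convex_indicator_induct [consumes 2, case_names convex indicator]:
  fixes t :: "nat \<Rightarrow> real"
  assumes "\<And>j. t j \<in> {0..1}" and "finite F"
    and convex: "\<And>c s s'. c \<in> {0..1} \<Longrightarrow> P s \<Longrightarrow> P s' \<Longrightarrow> P (\<lambda>j. c * s j + (1 - c) * s' j)"
    and indicator: "\<And>B. P (\<lambda>j. if j \<in> B then 1 else if j \<in> F then 0 else t j)"
  shows "P t"
proof -
  \<comment> \<open>\<open>G\<close> holds the coordinates already released to the values of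
    \<open>t\<close>. \<open>B\<close> must be arbitrary, as releasing \<open>g\<close> combines the
    sequences for \<open>insert g B\<close> and \<open>B\<close>.\<close>
  have "P (\<lambda>j. if j \<in> B then 1 else if j \<in> F - G then 0 else t j)"
    if "finite G" "G \<subseteq> F" for G B
    using that
  proof (induction G arbitrary: B)
    case empty
    show ?case unfolding Diff_empty by (rule indicator)
  next
    case (insert g G)
    let ?f = "\<lambda>G B j. if j \<in> B then 1 else if j \<in> F - G then 0 else t j"
    show ?case
    proof (cases "g \<in> B")
      case True
      then have "?f (insert g G) B = ?f G B" by (auto simp: fun_eq_iff)
      with insert show ?thesis by simp
    next
      case False
      have "P (?f G B)" for B
        using insert by (intro insert.IH) auto
      then have "P (\<lambda>j. t g * ?f G (insert g B) j + (1 - t g) * ?f G B j)"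
        by (intro convex assms(1))
      also have "(\<lambda>j. t g * ?f G (insert g B) j + (1 - t g) * ?f G B j) = ?f (insert g G) B"
        using False insert by (auto simp: fun_eq_iff algebra_simps)
      finally show ?thesis .
    qed
  qed
  from this[OF \<open>finite F\<close> subset_refl, of "{}"] show ?thesis by simp
qed

text \<open>The \<open>LEAST\<close> term names the block containing \<open>j\<close>. It serves
  twice: to assemble bad index sets into one set, and to glue permutations of blocks into one
  permutation.\<close>

lemma Least_block_eq:
  fixes N :: "nat \<Rightarrow> nat"
  assumes "strict_mono N" "N i \<le> j" "j < N (Suc i)"
  shows "(LEAST i. j < N (Suc i)) = i"
proof (rule Least_equality)
  show "i \<le> k" if "j < N (Suc k)" for k
    using assms that by (metis leD le_less_trans less_Suc_eq_le not_less strict_mono_less)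
qed (fact assms)

section \<open>Uniform convergence of multiplied series\<close>

text \<open>Gliding hump: blocks violating the bound are assembled into a single subseries whose uniform
  convergence they contradict. The common bound \<open>w\<close> replaces the supremum of the moduli, so no
  lattice completeness is needed.\<close>

lemma uniform_subseries_tails:
  fixes z :: "nat \<Rightarrow> 'a::banach_lattice"
  assumes sub: "\<And>B. \<exists>s. converges_uniformly (\<lambda>m. \<Sum>j\<in>B \<inter> {..<m}. z j) s"
    and "\<epsilon> > 0"
  shows "\<exists>m0. \<forall>m\<ge>m0. \<forall>n B. \<exists>w. norm w \<le> \<epsilon> \<and> (\<forall>k\<in>{m..n}. \<bar>\<Sum>j\<in>B \<inter> {m..<k}. z j\<bar> \<le> w)"
proof (rule ccontr)
  assume "\<not> ?thesis"
  then have "\<forall>m0. \<exists>m n B. m \<ge> m0 \<and>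
      (\<forall>w. (\<forall>k\<in>{m..n}. \<bar>\<Sum>j\<in>B \<inter> {m..<k}. z j\<bar> \<le> w) \<longrightarrow> norm w > \<epsilon>)"
    by (simp add: not_le) blast
  then obtain mm nn BB where mm: "\<And>a. mm a \<ge> a" and bad: "\<And>a w.
      (\<forall>k\<in>{mm a..nn a}. \<bar>\<Sum>j\<in>BB a \<inter> {mm a..<k}. z j\<bar> \<le> w) \<Longrightarrow> norm w > \<epsilon>"
    by metis
  \<comment> \<open>The next block starts beyond the bad window chosen after \<open>N i\<close>, so
    the windows are disjoint and a single \<open>B\<close> can copy all the bad sets.\<close>
  define N where "N = rec_nat (0::nat) (\<lambda>_ a. Suc (max (mm a) (nn a)))"
  have N_Suc: "N (Suc i) = Suc (max (mm (N i)) (nn (N i)))" for i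
    by (simp add: N_def)
  have "N i < N (Suc i)" for i
    using mm[of "N i"] unfolding N_Suc by linarith
  then have N: "strict_mono N" by (simp add: strict_mono_Suc_iff)
  define B where "B = {j. j \<in> BB (N (LEAST i. j < N (Suc i)))}"
  have B_eq: "B \<inter> {mm (N i)..<k} = BB (N i) \<inter> {mm (N i)..<k}" if "k \<le> nn (N i)" for i k
  proof -
    have "(LEAST i. j < N (Suc i)) = i" if "mm (N i) \<le> j" "j < k" for j
    proof (rule Least_block_eq[OF N])
      show "N i \<le> j" using that mm[of "N i"] by linarith
      show "j < N (Suc i)" using that \<open>k \<le> nn (N i)\<close> unfolding N_Suc by linarith
    qed
    then show ?thesis by (auto simp: B_def)
  qed
  define S where "S m = (\<Sum>j\<in>B \<inter> {..<m}. z j)" for m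
  obtain s u where u: "\<And>\<epsilon>. \<epsilon> > 0 \<Longrightarrow> \<exists>m0. \<forall>m\<ge>m0. \<bar>S m - s\<bar> \<le> \<epsilon> *\<^sub>R u"
    using sub[of B] unfolding converges_uniformly_def S_def by blast
  \<comment> \<open>A window sum is a difference of two partial sums, each within
    \<open>\<delta> *\<^sub>R u\<close> of \<open>s\<close>: hence the factor 2. The summand 1
    covers \<open>u = 0\<close>.\<close>
  define \<delta> where "\<delta> = \<epsilon> / (2 * (norm u + 1))"
  have pos: "norm u + 1 > 0" by (simp add: add_nonneg_pos)
  then have \<delta>: "\<delta> > 0" "2 * \<delta> * norm u \<le> \<epsilon>"
    using \<open>\<epsilon> > 0\<close> by (auto simp: \<delta>_def field_simps)
  then obtain k0 where k0: "\<And>m. m \<ge> k0 \<Longrightarrow> \<bar>S m - s\<bar> \<le> \<delta> *\<^sub>R u" using u by blast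
  define a where "a = N k0"
  have "k0 \<le> mm a"
    using mm[of a] strict_mono_imp_increasing[OF N, of k0] by (simp add: a_def)
  \<comment> \<open>The bound does not depend on \<open>k\<close>, so it is an admissible
    \<open>w\<close> for this window, yet its norm is at most \<open>\<epsilon>\<close>.\<close>
  have "\<bar>\<Sum>j\<in>BB a \<inter> {mm a..<k}. z j\<bar> \<le> (2 * \<delta>) *\<^sub>R u" if k: "k \<in> {mm a..nn a}" for k
  proof -
    have "S k = S (mm a) + (\<Sum>j\<in>B \<inter> {mm a..<k}. z j)"
      unfolding S_def using k
      by (subst sum.union_disjoint[symmetric]) (auto intro!: sum.cong)
    then have "(\<Sum>j\<in>BB a \<inter> {mm a..<k}. z j) = (S k - s) + (s - S (mm a))"
      using B_eq[of k k0] k by (simp add: a_def)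
    then have "\<bar>\<Sum>j\<in>BB a \<inter> {mm a..<k}. z j\<bar> \<le> \<bar>S k - s\<bar> + \<bar>s - S (mm a)\<bar>"
      using abs_triangle_ineq by metis
    also have "\<dots> \<le> \<delta> *\<^sub>R u + \<delta> *\<^sub>R u"
      using k0[of k] k0[of "mm a"] k \<open>k0 \<le> mm a\<close> by (intro add_mono) (auto simp: abs_minus_commute)
    also have "\<dots> = (2 * \<delta>) *\<^sub>R u" by (simp flip: scaleR_add_left)
    finally show ?thesis .
  qed
  then have "norm ((2 * \<delta>) *\<^sub>R u) > \<epsilon>" using bad[of a] by blast
  with \<delta> show False by simp
qed

text \<open>If \<open>w\<close> and \<open>w'\<close> serve two multipliers,
  \<open>c *\<^sub>R w + (1 - c) *\<^sub>R w'\<close> serves their convex combination, with norm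
  still at most \<open>\<epsilon>\<close>. As the window ends at \<open>n\<close>, only the finitely
  many coordinates in \<open>{..<n}\<close> have to be made zero or one.\<close>

lemma uniform_multiplier_tails:
  fixes z :: "nat \<Rightarrow> 'a::banach_lattice"
  assumes m: "\<And>B. \<exists>w. norm w \<le> \<epsilon> \<and> (\<forall>k\<in>{m..n}. \<bar>\<Sum>j\<in>B \<inter> {m..<k}. z j\<bar> \<le> w)"
    and t: "\<And>j. t j \<in> {0..1}"
  shows "\<exists>w. norm w \<le> \<epsilon> \<and> (\<forall>k\<in>{m..n}. \<bar>\<Sum>j\<in>{m..<k}. t j *\<^sub>R z j\<bar> \<le> w)"
  using t finite_lessThan[of n]
proof (induction t rule: convex_indicator_induct)
  case (convex c s s')
  from convex obtain w w' where w: "norm w \<le> \<epsilon>" "\<And>k. k\<in>{m..n} \<Longrightarrow> \<bar>\<Sum>j\<in>{m..<k}. s j *\<^sub>R z j\<bar> \<le> w"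
    and w': "norm w' \<le> \<epsilon>" "\<And>k. k\<in>{m..n} \<Longrightarrow> \<bar>\<Sum>j\<in>{m..<k}. s' j *\<^sub>R z j\<bar> \<le> w'" by blast
  have c: "\<bar>c\<bar> = c" "\<bar>1 - c\<bar> = 1 - c" using convex.hyps by auto
  have "norm (c *\<^sub>R w + (1 - c) *\<^sub>R w') \<le> c * norm w + (1 - c) * norm w'"
    using norm_triangle_ineq[of "c *\<^sub>R w" "(1 - c) *\<^sub>R w'"] c by simp
  also have "\<dots> \<le> \<epsilon>" using w(1) w'(1) convex.hyps by (intro convex_bound_le) auto
  finally have "norm (c *\<^sub>R w + (1 - c) *\<^sub>R w') \<le> \<epsilon>" .
  moreover have "\<bar>\<Sum>j\<in>{m..<k}. (c * s j + (1 - c) * s' j) *\<^sub>R z j\<bar> \<le> c *\<^sub>R w + (1 - c) *\<^sub>R w'"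
    if k: "k \<in> {m..n}" for k
  proof -
    have "(\<Sum>j\<in>{m..<k}. (c * s j + (1 - c) * s' j) *\<^sub>R z j)
        = c *\<^sub>R (\<Sum>j\<in>{m..<k}. s j *\<^sub>R z j) + (1 - c) *\<^sub>R (\<Sum>j\<in>{m..<k}. s' j *\<^sub>R z j)"
      by (simp add: scaleR_add_left sum.distrib flip: scaleR_scaleR scaleR_sum_right)
    also have "\<bar>\<dots>\<bar> \<le> \<bar>c *\<^sub>R (\<Sum>j\<in>{m..<k}. s j *\<^sub>R z j)\<bar> + \<bar>(1 - c) *\<^sub>R (\<Sum>j\<in>{m..<k}. s' j *\<^sub>R z j)\<bar>"
      by (rule abs_triangle_ineq)
    also have "\<dots> \<le> \<bar>c\<bar> *\<^sub>R \<bar>\<Sum>j\<in>{m..<k}. s j *\<^sub>R z j\<bar> + \<bar>1 - c\<bar> *\<^sub>R \<bar>\<Sum>j\<in>{m..<k}. s' j *\<^sub>R z j\<bar>"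
      by (intro add_mono abs_scaleR_le)
    also have "\<dots> \<le> c *\<^sub>R w + (1 - c) *\<^sub>R w'"
      unfolding c using k convex.hyps by (intro add_mono scaleR_left_mono w w') auto
    finally show ?thesis .
  qed
  ultimately show ?case by blast
next
  case (indicator B)
  obtain w where w: "norm w \<le> \<epsilon>" "\<And>k. k\<in>{m..n} \<Longrightarrow> \<bar>\<Sum>j\<in>B \<inter> {m..<k}. z j\<bar> \<le> w"
    using m[of B] by blast
  have "(\<Sum>j\<in>{m..<k}. (if j \<in> B then 1 else if j \<in> {..<n} then 0 else t j) *\<^sub>R z j)
      = (\<Sum>j\<in>B \<inter> {m..<k}. z j)" if "k \<in> {m..n}" for k
    using that by (intro sum.mono_neutral_cong_right) auto
  then show ?case using w by auto
qed

text \<open>The regulator is the sum \<open>u\<close> of all \<open>2 ^ i *\<^sub>R w i\<close>,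
  whose terms have norm at most \<open>(1/2) ^ i\<close>; the decay \<open>(1/4) ^ i\<close> leaves
  room for the weights. Sums of \<open>w l\<close> over \<open>l \<ge> i\<close> stay below
  \<open>(1/2) ^ i *\<^sub>R u\<close>, because the weights there are at least
  \<open>2 ^ i\<close>.\<close>

lemma converges_uniformly_if_block_bounds:
  fixes S :: "nat \<Rightarrow> 'a::banach_lattice"
  assumes N: "strict_mono N"
    and w: "\<And>i k. k \<in> {N i..N (Suc i)} \<Longrightarrow> \<bar>S k - S (N i)\<bar> \<le> w i"
    and norm_w: "\<And>i. norm (w i) \<le> (1/4) ^ i"
  shows "\<exists>s. converges_uniformly S s"
proof -
  have w0: "0 \<le> w i" for i
    using w[of "N i" i] strict_mono_mono[OF N] by (simp add: mono_def)
  have "summable (\<lambda>i. 2 ^ i *\<^sub>R w i)"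
  proof (rule summable_comparison_test')
    show "norm (2 ^ i *\<^sub>R w i) \<le> (1/2) ^ i" for i :: nat
    proof -
      have "norm (2 ^ i *\<^sub>R w i) \<le> 2 ^ i * (1/4) ^ i"
        using norm_w[of i] by (simp add: mult_left_mono)
      also have "\<dots> = (1/2) ^ i" by (simp flip: power_mult_distrib)
      finally show ?thesis .
    qed
  qed (auto intro: summable_geometric)
  define u where "u = (\<Sum>i. 2 ^ i *\<^sub>R w i)"
  have partial_u: "(\<Sum>i<n. 2 ^ i *\<^sub>R w i) \<le> u" for n
  proof -
    have "(\<lambda>k. (\<Sum>i<k. 2 ^ i *\<^sub>R w i) - (\<Sum>i<n. 2 ^ i *\<^sub>R w i)) \<longlonglongrightarrow> u - (\<Sum>i<n. 2 ^ i *\<^sub>R w i)"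
      using summable_LIMSEQ[OF \<open>summable _\<close>] unfolding u_def by (intro tendsto_intros)
    moreover have "0 \<le> (\<Sum>i<k. 2 ^ i *\<^sub>R w i) - (\<Sum>i<n. 2 ^ i *\<^sub>R w i)" if "k \<ge> n" for k
      using that w0 by (simp, intro sum_mono2) (auto intro!: scaleR_nonneg_nonneg)
    then have "eventually (\<lambda>k. 0 \<le> (\<Sum>i<k. 2 ^ i *\<^sub>R w i) - (\<Sum>i<n. 2 ^ i *\<^sub>R w i)) sequentially"
      unfolding eventually_sequentially by blast
    ultimately have "0 \<le> u - (\<Sum>i<n. 2 ^ i *\<^sub>R w i)"
      by (rule nonneg_limit_lattice) simp
    then show ?thesis by simp
  qed
  have tail: "\<bar>S k - S (N i)\<bar> \<le> (1/2) ^ i *\<^sub>R u" if "k \<ge> N i" for i k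
  proof -
    have telescope: "\<bar>S k - S (N i)\<bar> \<le> (\<Sum>l\<in>{i..<n}. w l)" if "i \<le> n" "N i \<le> k" "k \<le> N n" for n k
      using that
    proof (induction n arbitrary: k rule: dec_induct)
      case base
      then show ?case by simp
    next
      case (step n)
      show ?case
      proof (cases "k \<le> N n")
        case True
        have "\<bar>S k - S (N i)\<bar> \<le> (\<Sum>l\<in>{i..<n}. w l)" using step True by simp
        also have "\<dots> \<le> (\<Sum>l\<in>{i..<Suc n}. w l)" using step(1) w0 by simp
        finally show ?thesis .
      next
        case False
        have "\<bar>(S k - S (N n)) + (S (N n) - S (N i))\<bar> \<le> \<bar>S k - S (N n)\<bar> + \<bar>S (N n) - S (N i)\<bar>"
          by (rule abs_triangle_ineq)
        also have "\<dots> \<le> w n + (\<Sum>l\<in>{i..<n}. w l)"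
          using step False strict_mono_less_eq[OF N] by (intro add_mono w step.IH) auto
        finally show ?thesis using step(1) by (simp add: add.commute)
      qed
    qed
    \<comment> \<open>\<open>N (k + i)\<close> is merely a block boundary not before
      \<open>k\<close> at which the telescoping can stop.\<close>
    have "k \<le> N (k + i)"
      using strict_mono_imp_increasing[OF N, of "k + i"] by linarith
    then have "\<bar>S k - S (N i)\<bar> \<le> (\<Sum>l\<in>{i..<k + i}. w l)"
      using that by (intro telescope) auto
    also have "\<dots> \<le> (\<Sum>l\<in>{i..<k + i}. (1/2) ^ i *\<^sub>R 2 ^ l *\<^sub>R w l)"
    proof (rule sum_mono)
      fix l assume l: "l \<in> {i..<k + i}"
      have "(1::real) \<le> (1/2) ^ i * 2 ^ l"
        using l power_increasing[of i l "2::real"] by (simp add: field_simps power_divide)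
      then have "1 *\<^sub>R w l \<le> ((1/2) ^ i * 2 ^ l) *\<^sub>R w l"
        using w0 by (rule scaleR_right_mono)
      then show "w l \<le> (1/2) ^ i *\<^sub>R 2 ^ l *\<^sub>R w l" by simp
    qed
    also have "\<dots> = (1/2) ^ i *\<^sub>R (\<Sum>l\<in>{i..<k + i}. 2 ^ l *\<^sub>R w l)"
      by (simp only: scaleR_sum_right)
    also have "\<dots> \<le> (1/2) ^ i *\<^sub>R (\<Sum>l<k + i. 2 ^ l *\<^sub>R w l)"
      using w0 by (intro scaleR_left_mono sum_mono2) (auto intro!: scaleR_nonneg_nonneg)
    also have "\<dots> \<le> (1/2) ^ i *\<^sub>R u"
      by (intro scaleR_left_mono partial_u) simp
    finally show ?thesis .
  qed
  have lim0: "(\<lambda>i. (1/2) ^ i * c) \<longlonglongrightarrow> 0" for c :: real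
    by (intro tendsto_mult_left_zero LIMSEQ_power_zero) simp
  have "Cauchy S"
  proof (rule CauchyI)
    fix e :: real assume "e > 0"
    then have "eventually (\<lambda>i. (1/2) ^ i * norm u < e / 2) sequentially"
      by (intro order_tendstoD(2)[OF lim0]) simp
    then obtain i where i: "(1/2) ^ i * norm u < e / 2"
      unfolding eventually_sequentially by blast
    have "norm (S k - S (N i)) < e / 2" if "k \<ge> N i" for k
      using norm_le_if_abs_le[OF tail[OF that]] i by simp
    then show "\<exists>M. \<forall>m\<ge>M. \<forall>n\<ge>M. norm (S m - S n) < e"
      by (meson norm_triangle_half_l norm_minus_commute)
  qed
  then obtain s where s: "S \<longlonglongrightarrow> s" using Cauchy_convergent convergent_def by blast
  have s_tail: "\<bar>s - S (N i)\<bar> \<le> (1/2) ^ i *\<^sub>R u" for i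
  proof (rule le_limit_lattice)
    show "(\<lambda>k. \<bar>S k - S (N i)\<bar>) \<longlonglongrightarrow> \<bar>s - S (N i)\<bar>"
      by (intro tendsto_abs_lattice tendsto_intros s)
    show "eventually (\<lambda>k. \<bar>S k - S (N i)\<bar> \<le> (1/2) ^ i *\<^sub>R u) sequentially"
      using tail unfolding eventually_sequentially by blast
  qed simp
  have u0: "0 \<le> u" using partial_u[of 0] by simp
  have "\<exists>m0. \<forall>m\<ge>m0. \<bar>S m - s\<bar> \<le> \<epsilon> *\<^sub>R u" if "\<epsilon> > 0" for \<epsilon>
  proof -
    have "eventually (\<lambda>i. (1/2) ^ i * 2 < \<epsilon>) sequentially"
      using that by (intro order_tendstoD(2)[OF lim0])
    then obtain i where i: "(1/2) ^ i * 2 < \<epsilon>"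
      unfolding eventually_sequentially by blast
    have "\<bar>S k - s\<bar> \<le> \<epsilon> *\<^sub>R u" if "k \<ge> N i" for k
    proof -
      have "\<bar>(S k - S (N i)) + (S (N i) - s)\<bar> \<le> \<bar>S k - S (N i)\<bar> + \<bar>S (N i) - s\<bar>"
        by (rule abs_triangle_ineq)
      also have "\<dots> \<le> (1/2) ^ i *\<^sub>R u + (1/2) ^ i *\<^sub>R u"
        using tail[OF that] s_tail[of i] by (intro add_mono) (auto simp: abs_minus_commute)
      also have "\<dots> = ((1/2) ^ i * 2) *\<^sub>R u" by (simp flip: scaleR_add_left)
      also have "\<dots> \<le> \<epsilon> *\<^sub>R u" using i u0 by (intro scaleR_right_mono) auto
      finally show ?thesis by simp
    qed
    then show ?thesis by blast
  qed
  then show ?thesis unfolding converges_uniformly_def by blast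
qed

lemma converges_uniformly_multiplier01:
  fixes z :: "nat \<Rightarrow> 'a::banach_lattice"
  assumes sub: "\<And>B. \<exists>s. converges_uniformly (\<lambda>m. \<Sum>j\<in>B \<inter> {..<m}. z j) s"
    and t: "\<And>j. t j \<in> {0..1}"
  shows "\<exists>s. converges_uniformly (\<lambda>m. \<Sum>j<m. t j *\<^sub>R z j) s"
proof -
  have "\<exists>M. \<forall>i. \<forall>m\<ge>M i. \<forall>n B. \<exists>w. norm w \<le> (1/4) ^ i \<and> (\<forall>k\<in>{m..n}. \<bar>\<Sum>j\<in>B \<inter> {m..<k}. z j\<bar> \<le> w)"
    by (intro choice allI uniform_subseries_tails sub) simp
  then obtain M where M: "\<And>i m n B. m \<ge> M i \<Longrightarrow>
      \<exists>w. norm w \<le> (1/4) ^ i \<and> (\<forall>k\<in>{m..n}. \<bar>\<Sum>j\<in>B \<inter> {m..<k}. z j\<bar> \<le> w)" by blast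
  \<comment> \<open>The sum brings \<open>N i\<close> up to the threshold \<open>M i\<close> for the
    bound \<open>(1/4) ^ i\<close>; the summand \<open>i\<close> makes \<open>N\<close> strictly
    increasing.\<close>
  define N where "N i = i + (\<Sum>l\<le>i. M l)" for i
  have "strict_mono N" by (simp add: strict_mono_Suc_iff N_def)
  have "M i \<le> N i" for i
    using member_le_sum[of i "{..i}" M] by (simp add: N_def)
  then have "\<exists>w. norm w \<le> (1/4) ^ i \<and> (\<forall>k\<in>{N i..N (Suc i)}. \<bar>\<Sum>j\<in>{N i..<k}. t j *\<^sub>R z j\<bar> \<le> w)" for i
    by (intro uniform_multiplier_tails M t)
  then obtain w where w: "\<And>i. norm (w i) \<le> (1/4) ^ i"
      "\<And>i k. k\<in>{N i..N (Suc i)} \<Longrightarrow> \<bar>\<Sum>j\<in>{N i..<k}. t j *\<^sub>R z j\<bar> \<le> w i"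
    by metis
  have "(\<Sum>j<k. t j *\<^sub>R z j) - (\<Sum>j<n. t j *\<^sub>R z j) = (\<Sum>j\<in>{n..<k}. t j *\<^sub>R z j)" if "n \<le> k" for n k
    using that sum_diff_nat_ivl[of 0 n k "\<lambda>j. t j *\<^sub>R z j"] by (simp add: atLeast0LessThan)
  with w \<open>strict_mono N\<close> show ?thesis
    by (intro converges_uniformly_if_block_bounds[where N = N and w = w]) auto
qed

lemma bounded_eq_unit_interval_combination:
  fixes t :: "nat \<Rightarrow> real"
  assumes "\<And>j. \<bar>t j\<bar> \<le> C"
  obtains D r where "\<And>j. r j \<in> {0..1}" "\<And>j. t j = D * r j - C"
proof (cases "C = 0")
  case True
  then show ?thesis using that[of "\<lambda>_. 0" 0] assms by simp
next
  case False
  with assms[of 0] have "C > 0" by linarith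
  show ?thesis
  proof (rule that[of "\<lambda>j. (t j + C) / (2 * C)" "2 * C"])
    show "(t j + C) / (2 * C) \<in> {0..1}" "t j = 2 * C * ((t j + C) / (2 * C)) - C" for j
      using \<open>C > 0\<close> assms[of j] by (auto simp: abs_le_iff field_simps)
  qed
qed

text \<open>After an affine change of the multiplier, the constant part \<open>- C\<close> is
  carried by the full series, the subseries with \<open>B = UNIV\<close>.\<close>

lemma converges_uniformly_multiplier:
  fixes z :: "nat \<Rightarrow> 'a::banach_lattice"
  assumes sub: "\<And>B. \<exists>s. converges_uniformly (\<lambda>m. \<Sum>j\<in>B \<inter> {..<m}. z j) s"
    and t: "\<And>j. \<bar>t j\<bar> \<le> C"
  shows "\<exists>s. converges_uniformly (\<lambda>m. \<Sum>j<m. t j *\<^sub>R z j) s"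
proof -
  obtain D r where r: "\<And>j. r j \<in> {0..1}" and tr: "\<And>j. t j = D * r j - C"
    using bounded_eq_unit_interval_combination[of t C] t by metis
  obtain s where s: "converges_uniformly (\<lambda>m. \<Sum>j<m. r j *\<^sub>R z j) s"
    using converges_uniformly_multiplier01[of z r] sub r by blast
  obtain s' where s': "converges_uniformly (\<lambda>m. \<Sum>j<m. z j) s'"
    using sub[of UNIV] by auto
  have "(\<Sum>j<m. t j *\<^sub>R z j) = D *\<^sub>R (\<Sum>j<m. r j *\<^sub>R z j) + (- C) *\<^sub>R (\<Sum>j<m. z j)" for m
    by (simp add: tr scaleR_diff_left sum_subtractf scaleR_sum_right sum_negf)
  then show ?thesis
    using converges_uniformly_add[OF converges_uniformly_scaleR[OF s, of D] converges_uniformly_scaleR[OF s', of "- C"]]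
    by auto
qed

section \<open>Continuity of the coefficient functionals\<close>

lemma coeff_fun_sums:
  assumes "schauder_basis e E" "x \<in> E"
  shows "(\<lambda>k. coeff_fun e k x *\<^sub>R e k) sums x"
proof -
  obtain a where a: "(\<lambda>k. a k *\<^sub>R e k) sums x"
    using assms unfolding schauder_basis_def by blast
  then show ?thesis using coeff_fun_eqI[OF assms a] by simp
qed

lemma schauder_basis_nonzero:
  assumes "schauder_basis e E"
  shows "e n \<noteq> 0"
proof
  assume "e n = 0"
  define a where "a k = (if k = n then 1 else 0 :: real)" for k
  have "(\<lambda>k. a k *\<^sub>R e k) = (\<lambda>k. 0)" using \<open>e n = 0\<close> by (auto simp: a_def)
  then have "(\<lambda>k. a k *\<^sub>R e k) sums e n" "(\<lambda>k. 0 *\<^sub>R e k) sums e n" using \<open>e n = 0\<close> by auto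
  moreover have "e n \<in> E" using assms by (simp add: schauder_basis_def)
  ultimately have "coeff_fun e n (e n) = a n" "coeff_fun e n (e n) = 0"
    using coeff_fun_eqI[OF assms, of "e n" a] coeff_fun_eqI[OF assms, of "e n" "\<lambda>_. 0"] by blast+
  then show False by (simp add: a_def)
qed

lemma coeff_fun_linear:
  assumes "schauder_basis e E" "subspace E" "x \<in> E" "y \<in> E"
  shows coeff_fun_add: "coeff_fun e n (x + y) = coeff_fun e n x + coeff_fun e n y"
    and coeff_fun_diff: "coeff_fun e n (x - y) = coeff_fun e n x - coeff_fun e n y"
    and coeff_fun_scaleR: "coeff_fun e n (c *\<^sub>R x) = c * coeff_fun e n x"
proof -
  note sums = coeff_fun_sums[OF assms(1,3)] coeff_fun_sums[OF assms(1,4)]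
  show "coeff_fun e n (x + y) = coeff_fun e n x + coeff_fun e n y"
    using sums_add[OF sums] assms
    by (intro coeff_fun_eqI[OF assms(1)]) (auto intro: subspace_add simp: scaleR_add_left)
  show "coeff_fun e n (x - y) = coeff_fun e n x - coeff_fun e n y"
    using sums_diff[OF sums] assms
    by (intro coeff_fun_eqI[OF assms(1)]) (auto intro: subspace_diff simp: scaleR_diff_left)
  show "coeff_fun e n (c *\<^sub>R x) = c * coeff_fun e n x"
    using sums_scaleR_right[OF sums(1), of c] assms
    by (intro coeff_fun_eqI[OF assms(1)]) (auto intro: subspace_scale)
qed

lemma coeff_fun_basis:
  assumes "schauder_basis e E"
  shows "coeff_fun e n (e k) = (if k = n then 1 else 0)"
proof -
  have "(\<lambda>j. (if j = k then 1 else 0) *\<^sub>R e j) sums e k"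
    using sums_single[of k "\<lambda>_. e k"] by (simp add: if_distrib[of "\<lambda>c. c *\<^sub>R _"] if_distribR cong: if_cong)
  moreover have "e k \<in> E" using assms by (simp add: schauder_basis_def)
  ultimately show ?thesis using coeff_fun_eqI[OF assms] by fastforce
qed

section \<open>Canonical projections and their uniform bound\<close>

definition basis_proj :: "(nat \<Rightarrow> 'a::banach) \<Rightarrow> nat \<Rightarrow> 'a \<Rightarrow> 'a" where
  "basis_proj e n x = (\<Sum>k<n. coeff_fun e k x *\<^sub>R e k)"

lemma basis_proj_linear:
  assumes "schauder_basis e E" "subspace E" "x \<in> E" "y \<in> E"
  shows basis_proj_diff: "basis_proj e n (x - y) = basis_proj e n x - basis_proj e n y"
    and basis_proj_scaleR: "basis_proj e n (c *\<^sub>R x) = c *\<^sub>R basis_proj e n x"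
  using coeff_fun_linear[OF assms]
  by (simp_all add: basis_proj_def scaleR_diff_left sum_subtractf scaleR_sum_right)

lemma basis_proj_tendsto:
  assumes "schauder_basis e E" "x \<in> E"
  shows "(\<lambda>n. basis_proj e n x) \<longlonglongrightarrow> x"
  using coeff_fun_sums[OF assms] unfolding sums_def basis_proj_def .

text \<open>Baire's theorem in the complete space \<open>E\<close>. The sets \<open>K N\<close>
  cannot be assumed closed, since continuity of the projections is still to be proved, so the
  argument runs with their closures and yields only approximation of a ball by vectors with bounded
  projections.\<close>

lemma basis_proj_dense_bound:
  assumes basis: "schauder_basis e E" and "closed E" "subspace E"
  obtains r L where "r > 0"
    "\<And>x \<eta>. x \<in> E \<Longrightarrow> norm x < r \<Longrightarrow> \<eta> > 0 \<Longrightarrow>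
      \<exists>p\<in>E. norm (x - p) < \<eta> \<and> (\<forall>n. norm (basis_proj e n p) \<le> L)"
proof -
  define K where "K N = {x\<in>E. \<forall>n. norm (basis_proj e n x) \<le> real N}" for N :: nat
  let ?X = "top_of_set E"
  have cover: "E = (\<Union>N. closure (K N))"
  proof (intro equalityI subsetI)
    fix x assume "x \<in> E"
    have "Bseq (\<lambda>n. basis_proj e n x)"
      using basis_proj_tendsto[OF basis \<open>x \<in> E\<close>] by (intro convergent_imp_Bseq) (auto simp: convergent_def)
    then obtain c where c: "\<And>n. norm (basis_proj e n x) \<le> c" unfolding Bseq_def by blast
    obtain N :: nat where "c \<le> real N" using real_arch_simple by blast
    then have "x \<in> K N" using \<open>x \<in> E\<close> c unfolding K_def by (auto intro: order_trans)
    then show "x \<in> (\<Union>N. closure (K N))" using closure_subset by blast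
  next
    fix x assume "x \<in> (\<Union>N. closure (K N))"
    moreover have "closure (K N) \<subseteq> E" for N
      using \<open>closed E\<close> by (intro closure_minimal) (auto simp: K_def)
    ultimately show "x \<in> E" by blast
  qed
  have "completely_metrizable_space ?X"
    using \<open>closed E\<close> by (intro completely_metrizable_space_closedin completely_metrizable_space_euclidean) simp
  moreover have "?X interior_of (\<Union>N. closure (K N)) \<noteq> {}"
  proof -
    have "?X interior_of E = E" using interior_of_topspace[of ?X] by simp
    then show ?thesis using subspace_0[OF \<open>subspace E\<close>] unfolding cover[symmetric] by blast
  qed
  moreover have "closedin ?X (closure (K N))" for N
    using cover by (intro closed_subset) auto
  ultimately obtain N where "?X interior_of closure (K N) \<noteq> {}"
    using Baire_category_alt[of ?X "range (\<lambda>N. closure (K N))"] by auto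
  then obtain x0 U where x0: "x0 \<in> U" "openin ?X U" "U \<subseteq> closure (K N)"
    unfolding interior_of_def by blast
  then obtain r where r: "r > 0" "ball x0 r \<inter> E \<subseteq> U" and "x0 \<in> E"
    unfolding openin_contains_ball by blast
  show ?thesis
  proof
    show "r > 0" by fact
    fix x \<eta> assume x: "x \<in> E" "norm x < r" "(\<eta>::real) > 0"
    \<comment> \<open>\<open>K N\<close> is convex and symmetric: half the difference of
      approximants of \<open>x0 + x\<close> and \<open>x0 - x\<close> approximates \<open>x\<close>,
      which moves the ball to the origin and keeps the bound \<open>N\<close>.\<close>
    have "x0 + x \<in> ball x0 r \<inter> E" "x0 - x \<in> ball x0 r \<inter> E"
      using x \<open>x0 \<in> E\<close> \<open>subspace E\<close> by (auto simp: dist_norm subspace_add subspace_diff)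
    then have "x0 + x \<in> closure (K N)" "x0 - x \<in> closure (K N)"
      using r(2) x0(3) by blast+
    then obtain p q where p: "p \<in> K N" "dist p (x0 + x) < \<eta>" and q: "q \<in> K N" "dist q (x0 - x) < \<eta>"
      using x(3) unfolding closure_approachable by blast
    have pq: "p \<in> E" "q \<in> E" using p q by (auto simp: K_def)
    show "\<exists>p\<in>E. norm (x - p) < \<eta> \<and> (\<forall>n. norm (basis_proj e n p) \<le> real N)"
    proof (intro bexI conjI allI)
      show "(1/2) *\<^sub>R (p - q) \<in> E"
        using pq \<open>subspace E\<close> by (intro subspace_scale subspace_diff)
      have "x - (1/2) *\<^sub>R (p - q) = (1/2) *\<^sub>R ((q - (x0 - x)) - (p - (x0 + x)))"
        by (simp add: algebra_simps flip: scaleR_add_left)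
      then have "norm (x - (1/2) *\<^sub>R (p - q)) = norm ((q - (x0 - x)) - (p - (x0 + x))) / 2"
        by simp
      also have "\<dots> \<le> (dist q (x0 - x) + dist p (x0 + x)) / 2"
        unfolding dist_norm by (intro divide_right_mono norm_triangle_ineq4) simp
      also have "\<dots> < \<eta>" using p(2) q(2) by simp
      finally show "norm (x - (1/2) *\<^sub>R (p - q)) < \<eta>" .
      fix n
      have "norm (basis_proj e n ((1/2) *\<^sub>R (p - q))) = norm (basis_proj e n p - basis_proj e n q) / 2"
        using pq \<open>subspace E\<close>
        by (simp add: basis_proj_scaleR[OF basis \<open>subspace E\<close>] basis_proj_diff[OF basis \<open>subspace E\<close>] subspace_diff)
      also have "\<dots> \<le> (norm (basis_proj e n p) + norm (basis_proj e n q)) / 2"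
        by (intro divide_right_mono norm_triangle_ineq4) simp
      also have "\<dots> \<le> (real N + real N) / 2"
        using p(1) q(1) by (intro divide_right_mono add_mono) (auto simp: K_def)
      also have "\<dots> = real N" by simp
      finally show "norm (basis_proj e n ((1/2) *\<^sub>R (p - q))) \<le> real N" .
    qed
  qed
qed

text \<open>The successive approximation of the open mapping theorem: \<open>x\<close> is a rapidly converging
  series of vectors with bounded partial sum projections, and the coefficients can be added up
  because every series of projections is dominated by the same geometric series.\<close>

lemma basis_proj_bounded:
  assumes basis: "schauder_basis e E" and "closed E" "subspace E"
  obtains C where "\<And>x n. x \<in> E \<Longrightarrow> norm (basis_proj e n x) \<le> C * norm x"
proof -
  obtain r L where r: "r > 0" and dense: "\<And>x \<eta>. x \<in> E \<Longrightarrow> norm x < r \<Longrightarrow> \<eta> > 0 \<Longrightarrow>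
      \<exists>p\<in>E. norm (x - p) < \<eta> \<and> (\<forall>n. norm (basis_proj e n p) \<le> L)"
    using basis_proj_dense_bound[OF assms] by blast
  \<comment> \<open>A nonzero \<open>x\<close> is scaled to norm \<open>r / 2\<close> by
    \<open>c = r / (2 * norm x)\<close>; scaling the bound \<open>L\<close> back gives
    \<open>L / c = M * norm x\<close>.\<close>
  define M where "M = 2 * L / r"
  have approx: "\<exists>p\<in>E. norm (x - p) \<le> norm x / 2 \<and> (\<forall>n. norm (basis_proj e n p) \<le> M * norm x)"
    if x: "x \<in> E" for x
  proof (cases "x = 0")
    case True
    have "basis_proj e n 0 = 0" for n
      using basis_proj_scaleR[OF basis \<open>subspace E\<close> x x, of n 0] by simp
    then show ?thesis using True x by (intro bexI[of _ 0]) auto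
  next
    case False
    define c where "c = r / (2 * norm x)"
    have c: "c > 0" using r False by (simp add: c_def)
    have "c *\<^sub>R x \<in> E" using x \<open>subspace E\<close> by (intro subspace_scale)
    moreover have "norm (c *\<^sub>R x) < r" using r False by (simp add: c_def)
    moreover have "c * norm x / 2 > 0" using c False by simp
    ultimately obtain p where p: "p \<in> E" "norm (c *\<^sub>R x - p) < c * norm x / 2"
        "\<And>n. norm (basis_proj e n p) \<le> L"
      using dense by blast
    show ?thesis
    proof (intro bexI conjI allI)
      show "(1/c) *\<^sub>R p \<in> E" using p(1) \<open>subspace E\<close> by (intro subspace_scale)
      have "x - (1/c) *\<^sub>R p = (1/c) *\<^sub>R (c *\<^sub>R x - p)" using c by (simp add: algebra_simps)
      then have "norm (x - (1/c) *\<^sub>R p) = norm (c *\<^sub>R x - p) / c"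
        using c by (simp only: norm_scaleR) simp
      also have "\<dots> \<le> norm x / 2" using p(2) c by (simp add: field_simps)
      finally show "norm (x - (1/c) *\<^sub>R p) \<le> norm x / 2" .
      fix n
      have "norm (basis_proj e n ((1/c) *\<^sub>R p)) = norm (basis_proj e n p) / c"
        using c by (simp add: basis_proj_scaleR[OF basis \<open>subspace E\<close> p(1) p(1)])
      also have "\<dots> \<le> L / c" using p(3) c by (simp add: divide_right_mono)
      also have "\<dots> = M * norm x" using r False by (simp add: M_def c_def field_simps)
      finally show "norm (basis_proj e n ((1/c) *\<^sub>R p)) \<le> M * norm x" .
    qed
  qed
  then obtain P where P: "\<And>x. x \<in> E \<Longrightarrow> P x \<in> E" "\<And>x. x \<in> E \<Longrightarrow> norm (x - P x) \<le> norm x / 2"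
    "\<And>x n. x \<in> E \<Longrightarrow> norm (basis_proj e n (P x)) \<le> M * norm x"
    by metis
  have "norm (basis_proj e n x) \<le> (2 * M) * norm x" if x: "x \<in> E" for x n
  proof -
    \<comment> \<open>\<open>y i\<close> is the remainder after \<open>i\<close> corrections and
      \<open>P (y i)\<close> the next correction; the norm bound on the remainders halves each time,
      so the corrections sum to \<open>x\<close>.\<close>
    define y where "y = rec_nat x (\<lambda>_ v. v - P v)"
    have y_0: "y 0 = x" and y_Suc: "y (Suc i) = y i - P (y i)" for i by (simp_all add: y_def)
    define p where "p i = P (y i)" for i
    have yE: "y i \<in> E" for i
      by (induction i) (auto simp: y_0 y_Suc x P(1) intro!: subspace_diff[OF \<open>subspace E\<close>])
    have pE: "p i \<in> E" for i using yE P(1) by (simp add: p_def)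
    have norm_y: "norm (y i) \<le> (1/2) ^ i * norm x" for i
    proof (induction i)
      case (Suc i)
      then show ?case using P(2)[OF yE[of i]] by (simp add: y_Suc)
    qed (simp add: y_0)
    have "M \<ge> 0"
    proof -
      have "e 0 \<in> E" using basis by (simp add: schauder_basis_def)
      from P(3)[OF this, of 0] have "0 \<le> M * norm (e 0)" by (simp add: basis_proj_def)
      then show ?thesis using schauder_basis_nonzero[OF basis, of 0] by (simp add: zero_le_mult_iff)
    qed
    have proj_p: "norm (basis_proj e n (p i)) \<le> (1/2) ^ i * (M * norm x)" for n i
    proof -
      have "norm (basis_proj e n (p i)) \<le> M * norm (y i)" using P(3)[OF yE] by (simp add: p_def)
      also have "\<dots> \<le> M * ((1/2) ^ i * norm x)" using norm_y \<open>M \<ge> 0\<close> by (intro mult_left_mono)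
      finally show ?thesis by (simp add: mult_ac)
    qed
    have geom: "summable (\<lambda>i. (1/2::real) ^ i * c)" for c
      by (intro summable_mult2 summable_geometric) simp
    have norm_p: "norm (p i) \<le> (1/2) ^ i * (M * norm x)" for i
      by (rule Lim_norm_ubound[OF _ basis_proj_tendsto[OF basis pE]]) (use proj_p in auto)
    have "(\<Sum>i<k. p i) = x - y k" for k
      by (induction k) (auto simp: y_0 y_Suc p_def)
    moreover have "y \<longlonglongrightarrow> 0"
    proof (rule Lim_null_comparison)
      show "eventually (\<lambda>i. norm (y i) \<le> (1/2) ^ i * norm x) sequentially" using norm_y by simp
      show "(\<lambda>i. (1/2) ^ i * norm x) \<longlonglongrightarrow> 0"
        using geom by (rule summable_LIMSEQ_zero)
    qed
    ultimately have p_sums: "p sums x"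
      unfolding sums_def using tendsto_diff[OF tendsto_const[of x] \<open>y \<longlonglongrightarrow> 0\<close>] by simp
    \<comment> \<open>The candidate coefficient of \<open>x\<close>. It cannot yet be called
      \<open>coeff_fun e k x\<close>, since moving the functional through the series is the
      continuity sought.\<close>
    define a where "a k = (\<Sum>i. coeff_fun e k (p i))" for k
    have coeff_bound: "norm (coeff_fun e k (p i)) \<le> (1/2) ^ i * (2 * (M * norm x) / norm (e k))" for k i
    proof -
      have "coeff_fun e k (p i) *\<^sub>R e k = basis_proj e (Suc k) (p i) - basis_proj e k (p i)"
        by (simp add: basis_proj_def)
      then have "norm (coeff_fun e k (p i) *\<^sub>R e k) \<le> norm (basis_proj e (Suc k) (p i)) + norm (basis_proj e k (p i))"
        by (simp only: norm_triangle_ineq4)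
      also have "\<dots> \<le> (1/2) ^ i * (2 * (M * norm x))"
        using proj_p[of "Suc k" i] proj_p[of k i] by linarith
      finally show ?thesis using schauder_basis_nonzero[OF basis, of k] by (simp add: field_simps)
    qed
    have "summable (\<lambda>i. coeff_fun e k (p i))" for k
      using coeff_bound by (intro summable_comparison_test'[OF geom]) blast
    then have coeff_sums: "(\<lambda>i. coeff_fun e k (p i)) sums a k" for k
      by (simp add: a_def summable_sums)
    have proj_sums: "(\<lambda>i. basis_proj e n (p i)) sums (\<Sum>k<n. a k *\<^sub>R e k)" for n
      unfolding basis_proj_def by (intro sums_sum sums_scaleR_left coeff_sums)
    have bound: "norm (\<Sum>k<n. a k *\<^sub>R e k) \<le> (2 * M) * norm x" for n
    proof -
      have geom_sums: "(\<lambda>i. (1/2::real) ^ i * (M * norm x)) sums (2 * (M * norm x))"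
        using sums_mult2[OF geometric_sums[of "1/2::real"], of "M * norm x"] by simp
      have "norm (\<Sum>i. basis_proj e n (p i)) \<le> (\<Sum>i. (1/2) ^ i * (M * norm x))"
        using proj_p sums_summable[OF geom_sums] by (rule norm_suminf_le)
      then show ?thesis
        using sums_unique[OF geom_sums] sums_unique[OF proj_sums[of n]] by simp
    qed
    \<comment> \<open>The error of the \<open>n\<close>-th partial sum is at most the sum over
      \<open>i\<close> of \<open>?d i n\<close>. Each of these tends to 0 in \<open>n\<close>, and
      Tannery's theorem permits the limit under the sum; uniqueness of expansions then identifies
      \<open>a\<close>.\<close>
    have "(\<lambda>k. a k *\<^sub>R e k) sums x"
      unfolding sums_def
    proof (rule LIM_zero_cancel, rule Lim_null_comparison)
      let ?d = "\<lambda>i n. norm (basis_proj e n (p i) - p i)"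
      have d_le: "?d i n \<le> (1/2) ^ i * (2 * (M * norm x))" for i n
        using norm_triangle_ineq4[of "basis_proj e n (p i)" "p i"] proj_p[of n i] norm_p[of i] by linarith
      have "norm ((\<Sum>k<n. a k *\<^sub>R e k) - x) \<le> (\<Sum>i. ?d i n)" for n
      proof -
        have "(\<lambda>i. basis_proj e n (p i) - p i) sums ((\<Sum>k<n. a k *\<^sub>R e k) - x)"
          by (intro sums_diff proj_sums p_sums)
        moreover have "summable (\<lambda>i. ?d i n)"
          using d_le by (intro summable_comparison_test'[OF geom, of 0]) simp
        ultimately show ?thesis using summable_norm sums_unique by metis
      qed
      then show "eventually (\<lambda>n. norm ((\<Sum>k<n. a k *\<^sub>R e k) - x) \<le> (\<Sum>i. ?d i n)) sequentially" by simp
      have "(\<lambda>n. \<Sum>i. ?d i n) \<longlonglongrightarrow> (\<Sum>i::nat. 0::real)"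
      proof (intro conjunct2[OF conjunct2[OF tannerys_theorem[where M = "\<lambda>i. (1/2) ^ i * (2 * (M * norm x))"]]])
        show "?d i \<longlonglongrightarrow> 0" for i
          using basis_proj_tendsto[OF basis pE[of i]] by (simp add: LIM_zero tendsto_norm_zero)
        show "eventually (\<lambda>(k, n). norm (?d k n) \<le> (1/2) ^ k * (2 * (M * norm x))) (sequentially \<times>\<^sub>F sequentially)"
          using d_le by (intro always_eventually) auto
      qed (use geom in auto)
      then show "(\<lambda>n. \<Sum>i. ?d i n) \<longlonglongrightarrow> 0" by simp
    qed
    then have "coeff_fun e k x = a k" for k using coeff_fun_eqI[OF basis x] by blast
    then show ?thesis using bound by (simp add: basis_proj_def)
  qed
  then show ?thesis using that by blast
qed

text \<open>A term of the expansion is the difference of two consecutive canonical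
  projections.\<close>

lemma coeff_fun_bounded:
  assumes basis: "schauder_basis e E" and "closed E" "subspace E"
  obtains C where "\<And>x. x \<in> E \<Longrightarrow> \<bar>coeff_fun e n x\<bar> \<le> C * norm x"
proof -
  obtain C where C: "\<And>x n. x \<in> E \<Longrightarrow> norm (basis_proj e n x) \<le> C * norm x"
    using basis_proj_bounded[OF assms] by blast
  have "\<bar>coeff_fun e n x\<bar> \<le> (2 * C / norm (e n)) * norm x" if x: "x \<in> E" for x
  proof -
    have "coeff_fun e n x *\<^sub>R e n = basis_proj e (Suc n) x - basis_proj e n x"
      by (simp add: basis_proj_def)
    then have "norm (coeff_fun e n x *\<^sub>R e n) \<le> norm (basis_proj e (Suc n) x) + norm (basis_proj e n x)"
      by (simp only: norm_triangle_ineq4)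
    also have "\<dots> \<le> 2 * (C * norm x)"
      using C[OF x, of "Suc n"] C[OF x, of n] by linarith
    finally show ?thesis using schauder_basis_nonzero[OF basis, of n] by (simp add: field_simps)
  qed
  then show ?thesis using that by blast
qed

lemma coeff_fun_tendsto:
  assumes basis: "schauder_basis e E" and "closed E" "subspace E"
    and "s \<longlonglongrightarrow> x" "\<And>i. s i \<in> E" "x \<in> E"
  shows "(\<lambda>i. coeff_fun e n (s i)) \<longlonglongrightarrow> coeff_fun e n x"
proof -
  obtain C where C: "\<And>x. x \<in> E \<Longrightarrow> \<bar>coeff_fun e n x\<bar> \<le> C * norm x"
    using coeff_fun_bounded[OF basis \<open>closed E\<close> \<open>subspace E\<close>] by blast
  show ?thesis
  proof (rule LIM_zero_cancel, rule Lim_null_comparison)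
    have "norm (coeff_fun e n (s i) - coeff_fun e n x) \<le> C * norm (s i - x)" for i
      using C[of "s i - x"] assms
      by (simp add: coeff_fun_diff[OF basis \<open>subspace E\<close>] subspace_diff)
    then show "eventually (\<lambda>i. norm (coeff_fun e n (s i) - coeff_fun e n x) \<le> C * norm (s i - x)) sequentially"
      by simp
    show "(\<lambda>i. C * norm (s i - x)) \<longlonglongrightarrow> 0"
      using \<open>s \<longlonglongrightarrow> x\<close> by (intro tendsto_mult_right_zero tendsto_norm_zero LIM_zero)
  qed
qed

section \<open>Natural greedy orderings\<close>

text \<open>The predecessors of \<open>n\<close> have distinct ranks below that of \<open>n\<close>,
  and there are as many of them as that rank, so they fill an initial segment. The image is thus
  downward closed and infinite.\<close>

lemma rank_bij_betw:
  fixes R :: "'b \<Rightarrow> 'b \<Rightarrow> bool"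
  assumes irrefl: "\<And>i. \<not> R i i" and trans: "\<And>i j k. R i j \<Longrightarrow> R j k \<Longrightarrow> R i k"
    and total: "\<And>i j. i \<in> A \<Longrightarrow> j \<in> A \<Longrightarrow> i \<noteq> j \<Longrightarrow> R i j \<or> R j i"
    and "infinite A" and fin: "\<And>n. n \<in> A \<Longrightarrow> finite {i\<in>A. R i n}"
  shows "bij_betw (\<lambda>n. card {i\<in>A. R i n}) A UNIV"
proof -
  let ?r = "\<lambda>n. card {i\<in>A. R i n}"
  have mono: "?r i < ?r j" if "i \<in> A" "j \<in> A" "R i j" for i j
    using that irrefl trans fin by (intro psubset_card_mono psubsetI) blast+
  have inj: "inj_on ?r A"
  proof (rule inj_onI)
    fix i j assume "i \<in> A" "j \<in> A" "?r i = ?r j"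
    then show "i = j" using total[of i j] mono[of i j] mono[of j i] by auto
  qed
  have down: "?r ` {i\<in>A. R i n} = {..<?r n}" if "n \<in> A" for n
  proof (rule card_subset_eq)
    show "?r ` {i\<in>A. R i n} \<subseteq> {..<?r n}" using mono that by auto
    show "card (?r ` {i\<in>A. R i n}) = card {..<?r n}"
      using inj by (simp add: card_image inj_on_subset)
  qed simp
  have "k \<in> ?r ` A" for k
  proof -
    have "infinite (?r ` A)" using \<open>infinite A\<close> inj finite_imageD by blast
    then have "\<not> ?r ` A \<subseteq> {..k}" using finite_subset by blast
    then obtain n where "n \<in> A" "k < ?r n" by (meson atMost_iff image_subsetI not_le)
    then have "k \<in> ?r ` {i\<in>A. R i n}" using down by simp
    then show ?thesis by blast
  qed
  then show ?thesis using inj by (auto simp: bij_betw_def)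
qed

text \<open>Comparing positions shows that the predecessors are the earlier terms. Hence
  \<open>n\<close> can be read off from \<open>\<sigma> n\<close> and the range alone, which makes
  an increasing enumeration of a given range unique.\<close>

lemma increasing_enumeration_rank:
  fixes \<sigma> :: "nat \<Rightarrow> 'b"
  assumes irrefl: "\<And>i. \<not> R i i" and trans: "\<And>i j k. R i j \<Longrightarrow> R j k \<Longrightarrow> R i k"
    and \<sigma>: "\<And>j k. j < k \<Longrightarrow> R (\<sigma> j) (\<sigma> k)"
  shows "{i \<in> range \<sigma>. R i (\<sigma> n)} = \<sigma> ` {..<n}" "card {i \<in> range \<sigma>. R i (\<sigma> n)} = n"
proof -
  show eq: "{i \<in> range \<sigma>. R i (\<sigma> n)} = \<sigma> ` {..<n}"
  proof (intro equalityI subsetI)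
    fix i assume "i \<in> {i \<in> range \<sigma>. R i (\<sigma> n)}"
    then obtain k where k: "i = \<sigma> k" "R (\<sigma> k) (\<sigma> n)" by blast
    have "\<not> n < k" using \<sigma>[of n k] trans[OF k(2)] irrefl by blast
    moreover have "k \<noteq> n" using k(2) irrefl by blast
    ultimately show "i \<in> \<sigma> ` {..<n}" using k(1) by auto
  qed (use \<sigma> in blast)
  have "inj \<sigma>"
  proof (rule injI)
    fix j k assume "\<sigma> j = \<sigma> k"
    then show "j = k" using \<sigma>[of j k] \<sigma>[of k j] irrefl[of "\<sigma> k"] by (cases j k rule: linorder_cases) auto
  qed
  then have "inj_on \<sigma> {..<n}" by (rule inj_on_subset) simp
  then show "card {i \<in> range \<sigma>. R i (\<sigma> n)} = n" unfolding eq by (simp add: card_image)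
qed

lemma increasing_enumeration_unique:
  fixes \<sigma> \<tau> :: "nat \<Rightarrow> 'b"
  assumes irrefl: "\<And>i. \<not> R i i" and trans: "\<And>i j k. R i j \<Longrightarrow> R j k \<Longrightarrow> R i k"
    and \<sigma>: "\<And>j k. j < k \<Longrightarrow> R (\<sigma> j) (\<sigma> k)" and \<tau>: "\<And>j k. j < k \<Longrightarrow> R (\<tau> j) (\<tau> k)"
    and range: "range \<sigma> = range \<tau>"
  shows "\<sigma> = \<tau>"
proof
  fix n
  obtain m where m: "\<sigma> n = \<tau> m" using range by (metis rangeE rangeI)
  have "n = card {i \<in> range \<sigma>. R i (\<sigma> n)}"
    using increasing_enumeration_rank(2)[of R \<sigma>, OF irrefl trans \<sigma>] by simp
  also have "\<dots> = m"
    using increasing_enumeration_rank(2)[of R \<tau>, OF irrefl trans \<tau>] by (simp add: m range)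
  finally show "\<sigma> n = \<tau> n" using m by simp
qed

section \<open>Counting along an infinite set of indices\<close>

lemma enumerate_card:
  fixes B :: "nat set"
  assumes "infinite B" "n \<in> B"
  shows "enumerate B (card (B \<inter> {..<n})) = n"
proof -
  obtain k where k: "enumerate B k = n" using enumerate_Ex[OF assms] by blast
  have "card {i \<in> range (enumerate B). i < enumerate B k} = k"
    by (rule increasing_enumeration_rank(2)[where R = "(<)"]) (auto intro: enumerate_mono[OF _ assms(1)])
  then have "card {i \<in> B. i < n} = k"
    unfolding range_enumerate[OF assms(1)] k .
  moreover have "{i \<in> B. i < n} = B \<inter> {..<n}" by blast
  ultimately show ?thesis using k by simp
qed

text \<open>The counting function of \<open>B\<close> translates positions in the whole sequence
  into positions inside \<open>B\<close>; composed with it, greedy sums of a projection become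
  partial sums of a subseries.\<close>

lemma sum_enumerate_card:
  fixes f :: "nat \<Rightarrow> 'b::comm_monoid_add"
  assumes "infinite B"
  shows "(\<Sum>i<card (B \<inter> {..<m}). f (enumerate B i)) = sum f (B \<inter> {..<m})"
proof (induction m)
  case (Suc m)
  show ?case
  proof (cases "m \<in> B")
    case True
    then have "B \<inter> {..<Suc m} = insert m (B \<inter> {..<m})" by auto
    then show ?thesis using Suc enumerate_card[OF assms True] by (simp add: add.commute)
  next
    case False
    then have "B \<inter> {..<Suc m} = B \<inter> {..<m}" by (auto simp: less_Suc_eq)
    then show ?thesis using Suc by simp
  qed
qed simp

lemma filterlim_card_Int_lessThan:
  assumes "infinite B"
  shows "filterlim (\<lambda>m. card (B \<inter> {..<m})) at_top sequentially"
  unfolding filterlim_at_top eventually_sequentially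
proof
  fix k
  have "k \<le> card (B \<inter> {..<m})" if "m \<ge> enumerate B k" for m
  proof -
    have "enumerate B ` {..<k} \<subseteq> B \<inter> {..<m}"
      using enumerate_in_set[OF assms] enumerate_mono[OF _ assms] that by (auto intro: order_less_le_trans)
    then have "card (enumerate B ` {..<k}) \<le> card (B \<inter> {..<m})" by (intro card_mono) auto
    moreover have "inj_on (enumerate B) {..<k}"
      using strict_mono_enumerate[OF assms] strict_mono_imp_inj_on inj_on_subset by blast
    ultimately show ?thesis by (simp add: card_image)
  qed
  then show "\<exists>N. \<forall>m\<ge>N. k \<le> card (B \<inter> {..<m})" by blast
qed

lemma converges_uniformly_compose:
  assumes "converges_uniformly s x" "filterlim p at_top sequentially"
  shows "converges_uniformly (\<lambda>m. s (p m)) x"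
proof -
  obtain u where u: "\<And>\<epsilon>. \<epsilon> > 0 \<Longrightarrow> \<exists>m0. \<forall>m\<ge>m0. \<bar>s m - x\<bar> \<le> \<epsilon> *\<^sub>R u"
    using assms(1) unfolding converges_uniformly_def by blast
  have "\<exists>m0. \<forall>m\<ge>m0. \<bar>s (p m) - x\<bar> \<le> \<epsilon> *\<^sub>R u" if "\<epsilon> > 0" for \<epsilon>
    using u[OF that] assms(2) unfolding filterlim_at_top eventually_sequentially by meson
  then show ?thesis unfolding converges_uniformly_def by blast
qed

text \<open>The strict order of which natural greedy orderings are increasing enumerations. Its
  parameter is a coefficient sequence, so that orderings for different bases or vectors can be
  compared.\<close>

definition precedes :: "(nat \<Rightarrow> real) \<Rightarrow> nat \<Rightarrow> nat \<Rightarrow> bool" where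
  "precedes c i j \<longleftrightarrow> \<bar>c i\<bar> > \<bar>c j\<bar> \<or> \<bar>c i\<bar> = \<bar>c j\<bar> \<and> i < j"

lemma precedes_irrefl: "\<not> precedes c i i"
  and precedes_trans: "precedes c i j \<Longrightarrow> precedes c j k \<Longrightarrow> precedes c i k"
  and precedes_total: "i \<noteq> j \<Longrightarrow> precedes c i j \<or> precedes c j i"
  by (auto simp: precedes_def)

text \<open>Injectivity and monotonicity follow from being increasing for \<open>precedes\<close>.
  The criterion involves \<open>e\<close> and \<open>x\<close> only through the
  coefficients.\<close>

lemma natural_greedy_ordering_iff:
  "natural_greedy_ordering e x \<sigma> \<longleftrightarrow>
    {n. coeff_fun e n x \<noteq> 0} \<subseteq> range \<sigma> \<and>
    (\<forall>j k. j < k \<longrightarrow> precedes (\<lambda>n. coeff_fun e n x) (\<sigma> j) (\<sigma> k))"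
    (is "?L \<longleftrightarrow> ?R1 \<and> ?R2")
proof
  assume ?L
  then show "?R1 \<and> ?R2"
    by (auto simp: natural_greedy_ordering_def greedy_ordering_def basis_supp_def precedes_def)
next
  assume R: "?R1 \<and> ?R2"
  have "inj \<sigma>"
  proof (rule injI)
    fix j k assume "\<sigma> j = \<sigma> k"
    then show "j = k" using R precedes_irrefl[of _ "\<sigma> k"] by (metis linorder_neqE_nat)
  qed
  moreover have "decseq (\<lambda>n. \<bar>coeff_fun e (\<sigma> n) x\<bar>)"
    unfolding decseq_def
  proof (intro allI impI)
    fix m n :: nat assume "m \<le> n"
    then show "\<bar>coeff_fun e (\<sigma> n) x\<bar> \<le> \<bar>coeff_fun e (\<sigma> m) x\<bar>"
    proof (cases "m = n")
      case False
      then have "precedes (\<lambda>n. coeff_fun e n x) (\<sigma> m) (\<sigma> n)" using R \<open>m \<le> n\<close> by simp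
      then show ?thesis by (auto simp: precedes_def)
    qed simp
  qed
  ultimately show ?L
    using R by (auto simp: natural_greedy_ordering_def greedy_ordering_def basis_supp_def precedes_def)
qed

text \<open>Only finitely many coefficients exceed a given positive level, so each index of the
  chosen set \<open>A\<close> has finitely many predecessors; the inverse of the rank function is
  the ordering.\<close>

lemma natural_greedy_ordering_exists:
  assumes lim: "(\<lambda>n. coeff_fun e n x) \<longlonglongrightarrow> 0"
  shows "\<exists>\<sigma>. natural_greedy_ordering e x \<sigma>"
proof -
  define c where "c n = coeff_fun e n x" for n
  define S where "S = {n. c n \<noteq> 0}"
  \<comment> \<open>With infinite support an ordering cannot reach the indices with zero coefficient; with finite
    support it must continue with them.\<close>
  define A where "A = (if finite S then UNIV else S)"
  have "infinite A" "S \<subseteq> A" by (auto simp: A_def)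
  have large: "finite {i. \<bar>c i\<bar> \<ge> d}" if "d > 0" for d
  proof -
    have "eventually (\<lambda>i. \<bar>c i\<bar> < d) sequentially"
      using lim that unfolding c_def by (intro order_tendstoD(2)[OF tendsto_rabs_zero])
    then obtain N where "\<And>i. i \<ge> N \<Longrightarrow> \<bar>c i\<bar> < d" unfolding eventually_sequentially by blast
    then have "{i. \<bar>c i\<bar> \<ge> d} \<subseteq> {..<N}" by (auto simp: not_less[symmetric])
    then show ?thesis using finite_subset by blast
  qed
  have "finite {i\<in>A. precedes c i n}" if n: "n \<in> A" for n
  proof (cases "c n = 0")
    case False
    have "{i\<in>A. precedes c i n} \<subseteq> {i. \<bar>c i\<bar> \<ge> \<bar>c n\<bar>}" by (auto simp: precedes_def)
    then show ?thesis using large[of "\<bar>c n\<bar>"] False finite_subset by auto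
  next
    case True
    \<comment> \<open>A zero coefficient occurs in \<open>A\<close> only if the support is finite;
      its predecessors lie in the support or are smaller indices.\<close>
    then have "finite S" using n by (auto simp: A_def S_def split: if_splits)
    moreover have "{i\<in>A. precedes c i n} \<subseteq> S \<union> {..<n}"
      using True by (auto simp: precedes_def S_def)
    ultimately show ?thesis using finite_subset by blast
  qed
  then have bij: "bij_betw (\<lambda>n. card {i\<in>A. precedes c i n}) A UNIV" (is "bij_betw ?r A UNIV")
    using \<open>infinite A\<close> precedes_irrefl precedes_trans precedes_total by (intro rank_bij_betw)
  define \<sigma> where "\<sigma> = inv_into A ?r"
  have \<sigma>: "bij_betw \<sigma> UNIV A" unfolding \<sigma>_def using bij by (rule bij_betw_inv_into)
  have rank: "?r (\<sigma> j) = j" for j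
    unfolding \<sigma>_def using bij by (intro f_inv_into_f) (simp add: bij_betw_def)
  have \<sigma>A: "\<sigma> j \<in> A" for j using \<sigma> bij_betwE by blast
  have "precedes c (\<sigma> j) (\<sigma> k)" if "j < k" for j k
  proof (rule ccontr)
    assume "\<not> precedes c (\<sigma> j) (\<sigma> k)"
    moreover have "\<sigma> j \<noteq> \<sigma> k" using that rank by (metis less_irrefl)
    ultimately have "precedes c (\<sigma> k) (\<sigma> j)" using precedes_total by blast
    then have "{i\<in>A. precedes c i (\<sigma> k)} \<subseteq> {i\<in>A. precedes c i (\<sigma> j)}"
      using precedes_trans by blast
    then have "?r (\<sigma> k) \<le> ?r (\<sigma> j)"
      using \<open>\<And>n. n \<in> A \<Longrightarrow> finite {i\<in>A. precedes c i n}\<close> \<sigma>A by (intro card_mono) auto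
    with that show False unfolding rank by simp
  qed
  moreover have "S \<subseteq> range \<sigma>" using \<open>S \<subseteq> A\<close> \<sigma> by (simp add: bij_betw_def)
  ultimately show ?thesis unfolding natural_greedy_ordering_iff S_def c_def by blast
qed

text \<open>After a zero coefficient only zero coefficients can follow, so an index outside the
  support at position \<open>j\<close> would confine the support to finitely many positions.\<close>

lemma natural_greedy_ordering_range:
  assumes "natural_greedy_ordering e x \<sigma>" "infinite {n. coeff_fun e n x \<noteq> 0}"
  shows "range \<sigma> = {n. coeff_fun e n x \<noteq> 0}"
proof (intro equalityI subsetI)
  fix i assume "i \<in> range \<sigma>"
  then obtain j where j: "i = \<sigma> j" by blast
  have supp: "{n. coeff_fun e n x \<noteq> 0} \<subseteq> range \<sigma>"
    using assms(1) by (simp add: natural_greedy_ordering_iff)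
  have "\<not> {n. coeff_fun e n x \<noteq> 0} \<subseteq> \<sigma> ` {..j}"
    using assms(2) finite_subset by blast
  then obtain k where "coeff_fun e (\<sigma> k) x \<noteq> 0" "k > j" using supp by fastforce
  moreover from this have "precedes (\<lambda>n. coeff_fun e n x) (\<sigma> j) (\<sigma> k)"
    using assms(1) by (simp add: natural_greedy_ordering_iff)
  ultimately show "i \<in> {n. coeff_fun e n x \<noteq> 0}"
    using j by (auto simp: precedes_def)
qed (use assms(1) in \<open>auto simp: natural_greedy_ordering_iff\<close>)

text \<open>With infinite support the range is forced to be the support, so the \<open>SOME\<close>
  choice equals any given ordering.\<close>

lemma greedy_sum_eq:
  assumes \<sigma>: "natural_greedy_ordering e x \<sigma>" and inf: "infinite {n. coeff_fun e n x \<noteq> 0}"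
  shows "greedy_sum e m x = (\<Sum>n<m. coeff_fun e (\<sigma> n) x *\<^sub>R e (\<sigma> n))"
proof -
  define \<tau> where "\<tau> = (SOME \<sigma>. natural_greedy_ordering e x \<sigma>)"
  have \<tau>: "natural_greedy_ordering e x \<tau>" unfolding \<tau>_def by (rule someI[of _ \<sigma>]) (fact \<sigma>)
  have "\<tau> = \<sigma>"
  proof (rule increasing_enumeration_unique[where R = "precedes (\<lambda>n. coeff_fun e n x)"])
    show "range \<tau> = range \<sigma>"
      using natural_greedy_ordering_range[OF _ inf] \<sigma> \<tau> by simp
  qed (use \<sigma> \<tau> precedes_irrefl precedes_trans in \<open>auto simp: natural_greedy_ordering_iff\<close>)
  then show ?thesis by (simp add: greedy_sum_def Let_def flip: \<tau>_def)
qed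

section \<open>Unconditional bases\<close>

text \<open>Moving \<open>F\<close> to the front of its block turns a sum over \<open>F\<close> into
  a consecutive segment of a rearranged series, where the Cauchy criterion applies.\<close>

lemma exists_permutation_initial_image:
  fixes F :: "nat set"
  assumes "F \<subseteq> {a..<b}"
  shows "\<exists>p. bij_betw p {a..<b} {a..<b} \<and> p ` {a..<a + card F} = F"
proof -
  have fin: "finite F" using assms finite_subset by blast
  have le: "card F \<le> b - a" using card_mono[OF _ assms] by simp
  obtain f where f: "bij_betw f {a..<a + card F} F"
    using finite_same_card_bij[of "{a..<a + card F}" F] fin by auto
  have "card {a + card F..<b} = card ({a..<b} - F)"
    using assms fin by (simp add: card_Diff_subset)
  then obtain g where g: "bij_betw g {a + card F..<b} ({a..<b} - F)"
    using finite_same_card_bij[of "{a + card F..<b}" "{a..<b} - F"] by auto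
  let ?p = "\<lambda>j. if j \<in> {a..<a + card F} then f j else g j"
  have "bij_betw ?p ({a..<a + card F} \<union> {a + card F..<b}) (F \<union> ({a..<b} - F))"
    using f g by (intro bij_betw_disjoint_Un) auto
  moreover have "{a..<a + card F} \<union> {a + card F..<b} = {a..<b}" if "a \<le> b"
    using le that by auto
  moreover have "{a..<a + card F} \<union> {a + card F..<b} = {a..<b}" if "\<not> a \<le> b"
    using that assms by auto
  moreover have "F \<union> ({a..<b} - F) = {a..<b}" using assms by blast
  moreover have "?p ` {a..<a + card F} = F" using f by (auto simp: bij_betw_def)
  ultimately show ?thesis by metis
qed

lemma bij_glue_blocks:
  fixes N :: "nat \<Rightarrow> nat"
  assumes N: "strict_mono N" "N 0 = 0" and p: "\<And>i. bij_betw (p i) {N i..<N (Suc i)} {N i..<N (Suc i)}"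
  shows "bij (\<lambda>j. p (LEAST i. j < N (Suc i)) j)"
proof -
  define b where "b j = (LEAST i. j < N (Suc i))" for j
  have b_eq: "b j = i" if "j \<in> {N i..<N (Suc i)}" for i j
    using Least_block_eq[OF N(1)] that by (simp add: b_def)
  have b: "j \<in> {N (b j)..<N (Suc (b j))}" for j
  proof -
    have "j < N (Suc j)" using strict_mono_imp_increasing[OF N(1), of "Suc j"] by simp
    then have "j < N (Suc (b j))" unfolding b_def by (rule LeastI)
    moreover have "N (b j) \<le> j"
    proof (cases "b j")
      case 0
      then show ?thesis using N(2) by simp
    next
      case (Suc i)
      then have "\<not> j < N (Suc i)" using not_less_Least[of i "\<lambda>i. j < N (Suc i)"] by (simp add: b_def)
      then show ?thesis using Suc by simp
    qed
    ultimately show ?thesis by simp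
  qed
  have pb: "p (b j) j \<in> {N (b j)..<N (Suc (b j))}" for j
    using bij_betwE[OF p] b by blast
  show "bij (\<lambda>j. p (LEAST i. j < N (Suc i)) j)"
    unfolding b_def[symmetric]
  proof (rule bijI)
    show "inj (\<lambda>j. p (b j) j)"
    proof (rule injI)
      fix j k assume eq: "p (b j) j = p (b k) k"
      then have "b j = b k" using b_eq[OF pb[of j]] b_eq[OF pb[of k]] by simp
      then show "j = k"
        using eq bij_betw_imp_inj_on[OF p[of "b j"]] b[of j] b[of k] by (simp add: inj_on_def)
    qed
    show "surj (\<lambda>j. p (b j) j)"
    proof
      show "UNIV \<subseteq> range (\<lambda>j. p (b j) j)"
      proof
        fix k
        have "k \<in> p (b k) ` {N (b k)..<N (Suc (b k))}"
          using bij_betw_imp_surj_on[OF p] b by blast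
        then obtain j where j: "j \<in> {N (b k)..<N (Suc (b k))}" "k = p (b k) j" by blast
        have "k = p (b j) j" using j(2) unfolding b_eq[OF j(1)] .
        then show "k \<in> range (\<lambda>j. p (b j) j)" by (rule range_eqI)
      qed
    qed simp
  qed
qed

text \<open>Otherwise finite sets with sums larger than \<open>\<epsilon>\<close> in norm exist
  arbitrarily far out. One permutation makes infinitely many of them consecutive segments, and the
  rearranged series fails to be Cauchy.\<close>

lemma rearrangements_summable_imp_small_tails:
  fixes z :: "nat \<Rightarrow> 'a::real_normed_vector"
  assumes summable: "\<And>\<pi>. bij \<pi> \<Longrightarrow> summable (\<lambda>n. z (\<pi> n))" and "\<epsilon> > 0"
  shows "\<exists>m. \<forall>F. finite F \<longrightarrow> F \<subseteq> {m..} \<longrightarrow> norm (sum z F) \<le> \<epsilon>"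
proof (rule ccontr)
  assume "\<not> ?thesis"
  then have "\<forall>m. \<exists>F. finite F \<and> F \<subseteq> {m..} \<and> norm (sum z F) > \<epsilon>" by (simp add: not_le)
  then obtain F where F: "\<And>m. finite (F m)" "\<And>m. F m \<subseteq> {m..}" "\<And>m. norm (sum z (F m)) > \<epsilon>"
    by metis
  \<comment> \<open>\<open>insert 0\<close> keeps \<open>Max\<close> meaningful for an empty set;
    adding \<open>a\<close> and 1 puts the next start beyond both the current one and the set
    \<open>F a\<close>.\<close>
  define N where "N = rec_nat (0::nat) (\<lambda>_ a. Suc (a + Max (insert 0 (F a))))"
  have N_Suc: "N (Suc i) = Suc (N i + Max (insert 0 (F (N i))))" and N_0: "N 0 = 0" for i
    by (simp_all add: N_def)
  have N: "strict_mono N" by (simp add: strict_mono_Suc_iff N_Suc)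
  have FN: "F (N i) \<subseteq> {N i..<N (Suc i)}" for i
  proof
    fix j assume j: "j \<in> F (N i)"
    then have "j \<le> Max (insert 0 (F (N i)))" using F(1) by (intro Max_ge) auto
    then show "j \<in> {N i..<N (Suc i)}" using j F(2)[of "N i"] by (auto simp: N_Suc)
  qed
  have "\<forall>i. \<exists>p. bij_betw p {N i..<N (Suc i)} {N i..<N (Suc i)} \<and>
      p ` {N i..<N i + card (F (N i))} = F (N i)"
    using exists_permutation_initial_image[OF FN] by blast
  then obtain p where p: "\<And>i. bij_betw (p i) {N i..<N (Suc i)} {N i..<N (Suc i)}"
    "\<And>i. p i ` {N i..<N i + card (F (N i))} = F (N i)" by metis
  define \<pi> where "\<pi> j = p (LEAST i. j < N (Suc i)) j" for j
  have "bij \<pi>" using bij_glue_blocks[of N p] N N_0 p(1) unfolding \<pi>_def by blast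
  have "Cauchy (\<lambda>n. \<Sum>j<n. z (\<pi> j))"
    using summable[OF \<open>bij \<pi>\<close>] by (simp add: summable_iff_convergent convergent_Cauchy)
  then obtain M where M: "\<And>m n. m \<ge> M \<Longrightarrow> n \<ge> M \<Longrightarrow> norm ((\<Sum>j<m. z (\<pi> j)) - (\<Sum>j<n. z (\<pi> j))) < \<epsilon>"
    using \<open>\<epsilon> > 0\<close> CauchyD by blast
  define a c where "a = N M" and "c = card (F (N M))"
  have "M \<le> a" using strict_mono_imp_increasing[OF N] by (simp add: a_def)
  have "a + c \<le> N (Suc M)"
    using card_mono[OF _ FN[of M]] strict_monoD[OF N, of M "Suc M"] by (simp add: a_def c_def)
  have inj: "inj_on (p M) {a..<a + c}"
    using bij_betw_imp_inj_on[OF p(1)[of M]] \<open>a + c \<le> N (Suc M)\<close>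
    by (elim inj_on_subset) (auto simp: a_def)
  have "(\<Sum>j<a + c. z (\<pi> j)) - (\<Sum>j<a. z (\<pi> j)) = (\<Sum>j\<in>{a..<a + c}. z (\<pi> j))"
    using sum_diff_nat_ivl[of 0 a "a + c" "\<lambda>j. z (\<pi> j)"] by (simp add: atLeast0LessThan)
  also have "\<dots> = (\<Sum>j\<in>{a..<a + c}. z (p M j))"
    using \<open>a + c \<le> N (Suc M)\<close> Least_block_eq[OF N, of M]
    by (intro sum.cong) (auto simp: \<pi>_def a_def)
  also have "\<dots> = sum z (p M ` {a..<a + c})" using inj by (simp add: sum.reindex)
  also have "\<dots> = sum z (F (N M))" using p(2)[of M] by (simp add: a_def c_def)
  finally have "norm (sum z (F (N M))) < \<epsilon>" using M[of "a + c" a] \<open>M \<le> a\<close> by simp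
  with F(3)[of "N M"] show False by simp
qed

text \<open>Cauchy criterion for unordered sums: a finite set containing \<open>{..<m}\<close>
  changes the \<open>m\<close>-th partial sum only by a tail sum.\<close>

lemma small_tails_imp_summable_on:
  fixes z :: "nat \<Rightarrow> 'a::banach"
  assumes tails: "\<And>\<epsilon>. \<epsilon> > 0 \<Longrightarrow> \<exists>m. \<forall>F. finite F \<longrightarrow> F \<subseteq> {m..} \<longrightarrow> norm (sum z F) \<le> \<epsilon>"
  shows "z summable_on UNIV"
proof -
  have diff: "norm (sum z G - sum z {..<m}) \<le> \<epsilon>"
    if "\<forall>F. finite F \<longrightarrow> F \<subseteq> {m..} \<longrightarrow> norm (sum z F) \<le> \<epsilon>" "finite G" "{..<m} \<subseteq> G" for G m \<epsilon>
  proof -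
    have "sum z G - sum z {..<m} = sum z (G - {..<m})" using that by (simp add: sum_diff)
    then show ?thesis using that(1)[rule_format, of "G - {..<m}"] that(2) by force
  qed
  have "Cauchy (\<lambda>n. sum z {..<n})"
  proof (rule CauchyI)
    fix \<epsilon> :: real assume "\<epsilon> > 0"
    then obtain m where m: "\<forall>F. finite F \<longrightarrow> F \<subseteq> {m..} \<longrightarrow> norm (sum z F) \<le> \<epsilon> / 3"
      using tails[of "\<epsilon> / 3"] by auto
    have "norm (sum z {..<k} - sum z {..<n}) < \<epsilon>" if "k \<ge> m" "n \<ge> m" for k n
    proof -
      have "norm (sum z {..<k} - sum z {..<m}) \<le> \<epsilon> / 3" "norm (sum z {..<n} - sum z {..<m}) \<le> \<epsilon> / 3"
        using diff[OF m] that by auto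
      then show ?thesis
        using norm_triangle_ineq4[of "sum z {..<k} - sum z {..<m}" "sum z {..<n} - sum z {..<m}"] \<open>\<epsilon> > 0\<close> by simp
    qed
    then show "\<exists>M. \<forall>m\<ge>M. \<forall>n\<ge>M. norm (sum z {..<m} - sum z {..<n}) < \<epsilon>" by blast
  qed
  then obtain x where x: "(\<lambda>n. sum z {..<n}) \<longlonglongrightarrow> x" using Cauchy_convergent convergent_def by blast
  have "(z has_sum x) UNIV"
    unfolding has_sum_def
  proof (rule tendstoI)
    fix \<epsilon> :: real assume "\<epsilon> > 0"
    then obtain m where m: "\<forall>F. finite F \<longrightarrow> F \<subseteq> {m..} \<longrightarrow> norm (sum z F) \<le> \<epsilon> / 3"
      using tails[of "\<epsilon> / 3"] by auto
    have lim: "norm (x - sum z {..<m}) \<le> \<epsilon> / 3"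
    proof (rule Lim_norm_ubound[of sequentially])
      show "(\<lambda>n. sum z {..<n} - sum z {..<m}) \<longlonglongrightarrow> x - sum z {..<m}" by (intro tendsto_intros x)
      show "eventually (\<lambda>n. norm (sum z {..<n} - sum z {..<m}) \<le> \<epsilon> / 3) sequentially"
        using diff[OF m] unfolding eventually_sequentially by (intro exI[of _ m]) auto
    qed simp
    have "dist (sum z G) x < \<epsilon>" if "finite G" "{..<m} \<subseteq> G" for G
      using diff[OF m that] lim \<open>\<epsilon> > 0\<close> norm_triangle_ineq4[of "sum z G - sum z {..<m}" "x - sum z {..<m}"]
      by (simp add: dist_norm)
    then show "eventually (\<lambda>G. dist (sum z G) x < \<epsilon>) (finite_subsets_at_top UNIV)"
      unfolding eventually_finite_subsets_at_top by (intro exI[of _ "{..<m}"]) auto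
  qed
  then show ?thesis by (auto simp: summable_on_def)
qed

text \<open>A norm ball is convex, so the bound on finite sums beyond \<open>m\<close> passes from
  zero-one multipliers, which merely select a subset of \<open>F\<close>, to all others.\<close>

lemma rearrangements_summable_imp_multiplier_summable_on:
  fixes z :: "nat \<Rightarrow> 'a::banach"
  assumes summable: "\<And>\<pi>. bij \<pi> \<Longrightarrow> summable (\<lambda>n. z (\<pi> n))" and t: "\<And>j. t j \<in> {0..1::real}"
  shows "(\<lambda>j. t j *\<^sub>R z j) summable_on UNIV"
proof (rule small_tails_imp_summable_on)
  fix \<epsilon> :: real assume "\<epsilon> > 0"
  then obtain m where m: "\<And>F. finite F \<Longrightarrow> F \<subseteq> {m..} \<Longrightarrow> norm (sum z F) \<le> \<epsilon>"
    using rearrangements_summable_imp_small_tails[of z \<epsilon>] summable by blast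
  have "norm (\<Sum>j\<in>F. t j *\<^sub>R z j) \<le> \<epsilon>" if F: "finite F" "F \<subseteq> {m..}" for F
    using t F(1)
  proof (induction t rule: convex_indicator_induct)
    case (convex c s s')
    have "(\<Sum>j\<in>F. (c * s j + (1 - c) * s' j) *\<^sub>R z j)
        = c *\<^sub>R (\<Sum>j\<in>F. s j *\<^sub>R z j) + (1 - c) *\<^sub>R (\<Sum>j\<in>F. s' j *\<^sub>R z j)"
      by (simp add: scaleR_add_left sum.distrib flip: scaleR_scaleR scaleR_sum_right)
    also have "norm \<dots> \<le> \<bar>c\<bar> * norm (\<Sum>j\<in>F. s j *\<^sub>R z j) + \<bar>1 - c\<bar> * norm (\<Sum>j\<in>F. s' j *\<^sub>R z j)"
      by (metis norm_scaleR norm_triangle_ineq)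
    also have "\<dots> \<le> \<epsilon>" using convex by (intro convex_bound_le) auto
    finally show ?case .
  next
    case (indicator B)
    have "(\<Sum>j\<in>F. (if j \<in> B then 1 else if j \<in> F then 0 else t j) *\<^sub>R z j) = sum z (F \<inter> B)"
      using F(1) by (intro sum.mono_neutral_cong_right) auto
    then show ?case using m[of "F \<inter> B"] F by auto
  qed
  then show "\<exists>m. \<forall>F. finite F \<longrightarrow> F \<subseteq> {m..} \<longrightarrow> norm (\<Sum>j\<in>F. t j *\<^sub>R z j) \<le> \<epsilon>" by blast
qed

text \<open>The permuted basis supplies some expansion of \<open>x\<close>; applying the coefficient
  functionals of \<open>e\<close> to its partial sums shows that the coefficients are the original
  ones. This is where continuity of the functionals enters.\<close>

lemma unconditional_rearrangement_sums:
  fixes e :: "nat \<Rightarrow> 'a::banach"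
  assumes basis: "schauder_basis e E" and E: "closed E" "subspace E" and unc: "unconditional e"
    and x: "x \<in> E" and \<pi>: "bij \<pi>"
  shows "(\<lambda>n. coeff_fun e (\<pi> n) x *\<^sub>R e (\<pi> n)) sums x"
proof -
  have eE: "e n \<in> E" for n using basis by (simp add: schauder_basis_def)
  have "range (e \<circ> \<pi>) = range e" using \<pi> by (metis bij_is_surj image_comp)
  then have perm: "schauder_basis (e \<circ> \<pi>) (closure (span (range e)))"
    using unc \<pi> unfolding unconditional_def basic_sequence_def by metis
  have "x \<in> closure (span (range e))"
  proof (rule closed_sequentially[OF closed_closure])
    show "(\<lambda>n. basis_proj e n x) \<longlonglongrightarrow> x" by (rule basis_proj_tendsto[OF basis x])
    have "basis_proj e n x \<in> span (range e)" for n
      unfolding basis_proj_def by (intro span_sum span_scale span_base) simp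
    then show "basis_proj e n x \<in> closure (span (range e))" for n using closure_subset by blast
  qed
  from coeff_fun_sums[OF perm this] obtain b where b: "(\<lambda>n. b n *\<^sub>R (e \<circ> \<pi>) n) sums x" ..
  have "coeff_fun e (\<pi> k) x = b k" for k
  proof -
    have inE: "(\<Sum>n<m. b n *\<^sub>R e (\<pi> n)) \<in> E" for m
      using E(2) eE by (intro subspace_sum subspace_scale)
    have "coeff_fun e (\<pi> k) (\<Sum>n<m. b n *\<^sub>R e (\<pi> n)) = (\<Sum>n<m. if n = k then b n else 0)" for m
    proof (induction m)
      case 0
      show ?case
        using coeff_fun_scaleR[OF basis E(2) x x, of "\<pi> k" 0] by simp
    next
      case (Suc m)
      have "\<pi> m = \<pi> k \<longleftrightarrow> m = k" using \<pi> by (simp add: bij_is_inj inj_eq)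
      then show ?case
        using Suc by (simp add: coeff_fun_add[OF basis E(2) inE subspace_scale[OF E(2) eE]]
            coeff_fun_scaleR[OF basis E(2) eE eE] coeff_fun_basis[OF basis])
    qed
    then have ev: "coeff_fun e (\<pi> k) (\<Sum>n<m. b n *\<^sub>R e (\<pi> n)) = b k" if "m > k" for m
      using that by (simp add: sum.delta)
    have "(\<lambda>m. coeff_fun e (\<pi> k) (\<Sum>n<m. b n *\<^sub>R e (\<pi> n))) \<longlonglongrightarrow> coeff_fun e (\<pi> k) x"
      using b inE x unfolding sums_def comp_def by (intro coeff_fun_tendsto[OF basis E])
    moreover have "(\<lambda>m. coeff_fun e (\<pi> k) (\<Sum>n<m. b n *\<^sub>R e (\<pi> n))) \<longlonglongrightarrow> b k"
    proof (rule tendsto_eventually)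
      show "eventually (\<lambda>m. coeff_fun e (\<pi> k) (\<Sum>n<m. b n *\<^sub>R e (\<pi> n)) = b k) sequentially"
        by (rule eventually_mono[OF eventually_gt_at_top[of k] ev])
    qed
    ultimately show ?thesis by (rule LIMSEQ_unique)
  qed
  then show ?thesis using b by simp
qed

section \<open>Scaled bases\<close>

lemma sums_in_closed_subspace:
  fixes e :: "nat \<Rightarrow> 'a::real_normed_vector"
  assumes "closed E" "subspace E" "(\<lambda>n. c n *\<^sub>R e n) sums w" "\<And>n. e n \<in> E"
  shows "w \<in> E"
proof (rule closed_sequentially[OF \<open>closed E\<close>])
  show "(\<lambda>k. \<Sum>n<k. c n *\<^sub>R e n) \<longlonglongrightarrow> w" using assms(3) by (simp add: sums_def)
  show "(\<Sum>n<k. c n *\<^sub>R e n) \<in> E" for k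
    using assms(2,4) by (intro subspace_sum subspace_scale)
qed

text \<open>The terms indexed by \<open>B\<close> are, in the same order, the greedy sums of the
  coordinate projection of \<open>y\<close> onto \<open>\<sigma> ` B\<close>.\<close>

lemma greedy_subseries_converges_uniformly:
  assumes basis: "schauder_basis e E" and E: "closed E" "subspace E"
    and uqg: "uniformly_quasi_greedy e E"
    and y: "(\<lambda>n. coeff_fun e n y *\<^sub>R e n) summable_on UNIV"
    and \<sigma>: "natural_greedy_ordering e y \<sigma>"
  shows "\<exists>s. converges_uniformly (\<lambda>m. \<Sum>j\<in>B \<inter> {..<m}. coeff_fun e (\<sigma> j) y *\<^sub>R e (\<sigma> j)) s"
proof -
  define b where "b n = coeff_fun e n y" for n
  \<comment> \<open>The indices of the nonzero terms. If they are finitely many, the partial sums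
    become constant; otherwise \<open>B\<close> and the support are infinite, as
    \<open>enumerate\<close> and \<open>greedy_sum_eq\<close> require.\<close>
  define W where "W = {j\<in>B. b (\<sigma> j) \<noteq> 0}"
  show ?thesis
  proof (cases "finite W")
    case True
    then obtain m0 where m0: "W \<subseteq> {..<m0}" using finite_nat_iff_bounded by blast
    have "(\<Sum>j\<in>B \<inter> {..<m}. b (\<sigma> j) *\<^sub>R e (\<sigma> j)) = (\<Sum>j\<in>W. b (\<sigma> j) *\<^sub>R e (\<sigma> j))" if "m \<ge> m0" for m
      using m0 that by (intro sum.mono_neutral_right) (auto simp: W_def)
    then have "eventually (\<lambda>m. (\<Sum>j\<in>B \<inter> {..<m}. b (\<sigma> j) *\<^sub>R e (\<sigma> j)) = (\<Sum>j\<in>W. b (\<sigma> j) *\<^sub>R e (\<sigma> j))) sequentially"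
      unfolding eventually_sequentially by blast
    then show ?thesis unfolding b_def by (intro exI converges_uniformly_const_eventually)
  next
    case False
    moreover have "W \<subseteq> B" by (auto simp: W_def)
    ultimately have "infinite B" using finite_subset by blast
    have inj: "inj \<sigma>" using \<sigma> by (simp add: natural_greedy_ordering_def greedy_ordering_def)
    have "infinite (\<sigma> ` W)" using False inj finite_imageD inj_on_subset by blast
    moreover have "\<sigma> ` W \<subseteq> {n. b n \<noteq> 0}" by (auto simp: W_def)
    ultimately have "infinite {n. b n \<noteq> 0}" using finite_subset by blast
    then have b_nz: "b (\<sigma> j) \<noteq> 0" for j
      using natural_greedy_ordering_range[OF \<sigma>] unfolding b_def by blast
    define c where "c n = (if n \<in> \<sigma> ` B then b n else 0)" for n
    have "(\<lambda>n. b n *\<^sub>R e n) summable_on \<sigma> ` B"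
      using y unfolding b_def by (rule summable_on_subset_banach) simp
    also have "?this \<longleftrightarrow> (\<lambda>n. c n *\<^sub>R e n) summable_on UNIV"
      by (intro summable_on_cong_neutral) (auto simp: c_def)
    finally have "summable (\<lambda>n. c n *\<^sub>R e n)" by (rule summable_on_imp_summable)
    then obtain w where w: "(\<lambda>n. c n *\<^sub>R e n) sums w" by (auto simp: summable_def)
    have "w \<in> E"
      using sums_in_closed_subspace[OF E w] basis by (simp add: schauder_basis_def)
    have coeff_w: "coeff_fun e n w = c n" for n
      using coeff_fun_eqI[OF basis \<open>w \<in> E\<close> w] .
    \<comment> \<open>A subsequence of an increasing enumeration is increasing, and \<open>w\<close>
      has the coefficients of \<open>y\<close> along it.\<close>
    define \<tau> where "\<tau> i = \<sigma> (enumerate B i)" for i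
    have coeff_\<tau>: "coeff_fun e (\<tau> i) w = b (\<tau> i)" for i
      using enumerate_in_set[OF \<open>infinite B\<close>] by (simp add: coeff_w c_def \<tau>_def)
    have range_\<tau>: "range \<tau> = \<sigma> ` B"
      using image_image[of \<sigma> "enumerate B" UNIV] by (simp add: \<tau>_def range_enumerate[OF \<open>infinite B\<close>])
    have supp_w: "{n. coeff_fun e n w \<noteq> 0} = range \<tau>"
      using b_nz by (auto simp: range_\<tau> coeff_w c_def)
    have "natural_greedy_ordering e w \<tau>"
      unfolding natural_greedy_ordering_iff
    proof (intro conjI allI impI)
      show "{n. coeff_fun e n w \<noteq> 0} \<subseteq> range \<tau>" using supp_w by simp
      fix j k :: nat assume "j < k"
      then have "precedes b (\<tau> j) (\<tau> k)"
        using \<sigma> enumerate_mono[OF _ \<open>infinite B\<close>] by (simp add: natural_greedy_ordering_iff \<tau>_def b_def[abs_def])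
      then show "precedes (\<lambda>n. coeff_fun e n w) (\<tau> j) (\<tau> k)" by (simp add: precedes_def coeff_\<tau>)
    qed
    moreover have "infinite {n. coeff_fun e n w \<noteq> 0}"
      unfolding supp_w range_\<tau> using \<open>infinite B\<close> inj finite_imageD inj_on_subset by blast
    ultimately have "greedy_sum e m w = (\<Sum>i<m. b (\<tau> i) *\<^sub>R e (\<tau> i))" for m
      by (simp add: greedy_sum_eq coeff_\<tau>)
    moreover have "converges_uniformly (\<lambda>m. greedy_sum e m w) w"
      using uqg \<open>w \<in> E\<close> by (simp add: uniformly_quasi_greedy_def)
    ultimately have "converges_uniformly (\<lambda>m. \<Sum>i<m. b (\<tau> i) *\<^sub>R e (\<tau> i)) w" by simp
    from converges_uniformly_compose[OF this filterlim_card_Int_lessThan[OF \<open>infinite B\<close>]]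
    have "converges_uniformly (\<lambda>m. \<Sum>j\<in>B \<inter> {..<m}. b (\<sigma> j) *\<^sub>R e (\<sigma> j)) w"
      unfolding \<tau>_def sum_enumerate_card[OF \<open>infinite B\<close>, where f = "\<lambda>j. b (\<sigma> j) *\<^sub>R e (\<sigma> j)"] .
    then show ?thesis unfolding b_def by blast
  qed
qed

text \<open>Terms of a convergent series tend to zero, and \<open>norm (e n)\<close> is bounded away
  from zero.\<close>

lemma coeff_fun_tendsto_0:
  assumes basis: "schauder_basis e E" and semi: "semi_normalized e" and x: "x \<in> E"
  shows "(\<lambda>n. coeff_fun e n x) \<longlonglongrightarrow> 0"
proof (rule Lim_null_comparison)
  define d where "d = (INF n. norm (e n))"
  have d: "d > 0" using semi by (simp add: semi_normalized_def d_def)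
  have d_le: "d \<le> norm (e n)" for n
    unfolding d_def by (intro cINF_lower) (auto intro: bdd_belowI[of _ 0])
  have "norm (coeff_fun e n x) \<le> norm (coeff_fun e n x *\<^sub>R e n) / d" for n
    using d mult_left_mono[OF d_le[of n], of "\<bar>coeff_fun e n x\<bar>"] by (simp add: field_simps)
  then show "eventually (\<lambda>n. norm (coeff_fun e n x) \<le> norm (coeff_fun e n x *\<^sub>R e n) / d) sequentially" by simp
  show "(\<lambda>n. norm (coeff_fun e n x *\<^sub>R e n) / d) \<longlonglongrightarrow> 0"
    using summable_LIMSEQ_zero[OF sums_summable[OF coeff_fun_sums[OF basis x]]]
    by (intro tendsto_divide_zero tendsto_norm_zero)
qed

lemma unconditional_multiplier_summable_on:
  fixes e :: "nat \<Rightarrow> 'a::banach"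
  assumes basis: "schauder_basis e E" and E: "closed E" "subspace E" and unc: "unconditional e"
    and x: "x \<in> E" and t: "\<And>n. \<bar>t n\<bar> \<le> C"
  shows "(\<lambda>n. (t n * coeff_fun e n x) *\<^sub>R e n) summable_on UNIV"
proof -
  have summable: "summable (\<lambda>n. coeff_fun e (\<pi> n) x *\<^sub>R e (\<pi> n))" if "bij \<pi>" for \<pi>
    using unconditional_rearrangement_sums[OF basis E unc x that] by (rule sums_summable)
  obtain D r where r: "\<And>j. r j \<in> {0..1}" and tr: "\<And>j. t j = D * r j - C"
    using bounded_eq_unit_interval_combination[of t C] t by metis
  have *: "(\<lambda>n. s n *\<^sub>R coeff_fun e n x *\<^sub>R e n) summable_on UNIV" if "\<And>n. s n \<in> {0..1}" for s
    using rearrangements_summable_imp_multiplier_summable_on[of "\<lambda>n. coeff_fun e n x *\<^sub>R e n" s] summable that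
    by blast
  have "(\<lambda>n. D *\<^sub>R r n *\<^sub>R coeff_fun e n x *\<^sub>R e n + (- C) *\<^sub>R 1 *\<^sub>R coeff_fun e n x *\<^sub>R e n) summable_on UNIV"
    using *[OF r] *[of "\<lambda>_. 1"] by (intro summable_on_add summable_on_scaleR_right) auto
  then show ?thesis by (simp add: tr algebra_simps)
qed

theorem proposition3p2:
  fixes E :: "'a::banach_lattice set" and e :: "nat \<Rightarrow> 'a" and l :: "nat \<Rightarrow> real"
  assumes "closed E" and "subspace E"
    and "schauder_basis e E"
    and "semi_normalized e"
    and "unconditional e"
    and "uniformly_quasi_greedy e E"
    and "0 < (INF n. \<bar>l n\<bar>)" and "bdd_above (range (\<lambda>n. \<bar>l n\<bar>))"
  shows "uniformly_quasi_greedy (\<lambda>n. l n *\<^sub>R e n) E"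
proof -
  note E = \<open>closed E\<close> \<open>subspace E\<close> and basis = \<open>schauder_basis e E\<close> and unc = \<open>unconditional e\<close>
  define c where "c = (INF n. \<bar>l n\<bar>)"
  have "c > 0" using assms(7) by (simp add: c_def)
  have c_le: "c \<le> \<bar>l n\<bar>" for n
    unfolding c_def by (intro cINF_lower) (auto intro: bdd_belowI[of _ 0])
  then have l_nz: "l n \<noteq> 0" for n using \<open>c > 0\<close> by (metis abs_zero not_less)
  obtain C where C: "\<And>n. \<bar>l n\<bar> \<le> C" using assms(8) by (auto simp: bdd_above_def)
  note basis_l = schauder_basis_scale[OF basis E(2), of l, OF l_nz]
  have "converges_uniformly (\<lambda>m. greedy_sum (\<lambda>n. l n *\<^sub>R e n) m x) x" if x: "x \<in> E" for x
  proof -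
    have inv_l: "\<bar>inverse (l n)\<bar> \<le> inverse c" for n
      using c_le[of n] \<open>c > 0\<close> by (simp add: le_imp_inverse_le)
    have "(\<lambda>n. (inverse (l n) * coeff_fun e n x) *\<^sub>R e n) summable_on UNIV"
      by (rule unconditional_multiplier_summable_on[OF basis E unc x inv_l])
    then obtain y where y: "((\<lambda>n. (inverse (l n) * coeff_fun e n x) *\<^sub>R e n) has_sum y) UNIV"
      by (auto simp: summable_on_def)
    have y_sums: "(\<lambda>n. (inverse (l n) * coeff_fun e n x) *\<^sub>R e n) sums y"
      using y by (rule has_sum_imp_sums)
    have "y \<in> E"
      using sums_in_closed_subspace[OF E y_sums] basis by (simp add: schauder_basis_def)
    have coeff_y: "coeff_fun e n y = inverse (l n) * coeff_fun e n x" for n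
      using coeff_fun_eqI[OF basis \<open>y \<in> E\<close> y_sums] .
    have coeff_l: "coeff_fun (\<lambda>n. l n *\<^sub>R e n) n x = coeff_fun e n y" for n
      unfolding coeff_y by (rule coeff_fun_scale[OF basis E(2) l_nz x])
    have ordering: "natural_greedy_ordering (\<lambda>n. l n *\<^sub>R e n) x = natural_greedy_ordering e y"
      by (simp add: fun_eq_iff natural_greedy_ordering_iff coeff_l)
    \<comment> \<open>Since the two ordering predicates coincide, the \<open>SOME\<close> inside
      \<open>greedy_sum\<close> for the scaled basis is this very \<open>\<sigma>\<close>.\<close>
    define \<sigma> where "\<sigma> = (SOME \<sigma>. natural_greedy_ordering e y \<sigma>)"
    have \<sigma>: "natural_greedy_ordering e y \<sigma>"
      unfolding \<sigma>_def
      using natural_greedy_ordering_exists[OF coeff_fun_tendsto_0[OF basis \<open>semi_normalized e\<close> \<open>y \<in> E\<close>]]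
      by (rule someI_ex)
    have greedy: "greedy_sum (\<lambda>n. l n *\<^sub>R e n) m x = (\<Sum>j<m. l (\<sigma> j) *\<^sub>R coeff_fun e (\<sigma> j) y *\<^sub>R e (\<sigma> j))" for m
      unfolding greedy_sum_def Let_def ordering \<sigma>_def[symmetric] coeff_l by (simp add: mult.commute)
    have "(\<lambda>n. coeff_fun e n y *\<^sub>R e n) summable_on UNIV"
      using y by (auto simp: coeff_y summable_on_def)
    then have "\<exists>s. converges_uniformly (\<lambda>m. \<Sum>j\<in>B \<inter> {..<m}. coeff_fun e (\<sigma> j) y *\<^sub>R e (\<sigma> j)) s" for B
      using greedy_subseries_converges_uniformly[OF basis E \<open>uniformly_quasi_greedy e E\<close> _ \<sigma>] by blast
    then obtain s where s: "converges_uniformly (\<lambda>m. greedy_sum (\<lambda>n. l n *\<^sub>R e n) m x) s"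
      using converges_uniformly_multiplier[of _ "\<lambda>j. l (\<sigma> j)", OF _ C] unfolding greedy by blast
    \<comment> \<open>Identification of the limit: an unordered sum may be reindexed along
      \<open>\<sigma>\<close>, and indices missed by \<open>\<sigma>\<close> have coefficient zero
      in \<open>y\<close>, hence in \<open>x\<close>.\<close>
    have "((\<lambda>n. coeff_fun e n x *\<^sub>R e n) has_sum x) UNIV"
    proof -
      have "(\<lambda>n. coeff_fun e n x *\<^sub>R e n) summable_on UNIV"
        using unconditional_multiplier_summable_on[OF basis E unc x, of "\<lambda>_. 1" 1] by simp
      then obtain x' where x': "((\<lambda>n. coeff_fun e n x *\<^sub>R e n) has_sum x') UNIV"
        by (auto simp: summable_on_def)
      then have "x' = x"
        using has_sum_imp_sums coeff_fun_sums[OF basis x] sums_unique2 by blast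
      with x' show ?thesis by simp
    qed
    also have "?this \<longleftrightarrow> ((\<lambda>n. coeff_fun e n x *\<^sub>R e n) has_sum x) (range \<sigma>)"
    proof (rule has_sum_cong_neutral)
      fix n assume "n \<in> UNIV - range \<sigma>"
      then have "coeff_fun e n y = 0" using \<sigma> by (auto simp: natural_greedy_ordering_iff)
      then show "coeff_fun e n x *\<^sub>R e n = 0" using l_nz by (simp add: coeff_y)
    qed auto
    also have "\<dots> \<longleftrightarrow> ((\<lambda>j. coeff_fun e (\<sigma> j) x *\<^sub>R e (\<sigma> j)) has_sum x) UNIV"
      using \<sigma> by (subst has_sum_reindex) (auto simp: natural_greedy_ordering_def greedy_ordering_def o_def)
    finally have "(\<lambda>j. coeff_fun e (\<sigma> j) x *\<^sub>R e (\<sigma> j)) sums x" by (rule has_sum_imp_sums)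
    then have "(\<lambda>m. greedy_sum (\<lambda>n. l n *\<^sub>R e n) m x) \<longlonglongrightarrow> x"
      using l_nz by (simp add: sums_def greedy coeff_y flip: mult.assoc)
    then have "s = x" using converges_uniformly_imp_tendsto[OF s] LIMSEQ_unique by blast
    with s show ?thesis by simp
  qed
  with basis_l show ?thesis by (simp add: uniformly_quasi_greedy_def)
qed

end
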